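(* Consider the game, the pseudo-gradient $F$, the multiplier graph $\mathcal G_\lambda$, Assumptions 1–3, and the iteration (distributed algorithm) described in the context. Suppose Assumptions 1–3 hold. Let $d^*=\max_{i}d_i$ and let $0<\beta\le\min\{\frac{1}{2d^*},\frac{\eta}{\theta^2}\}$, where $\eta,\theta$ are the constants of Assumption 2. Let $\delta>\frac{1}{2\beta}$, and suppose that the step-sizes $\tau_i,\nu_i,\sigma_i>0$ satisfy, for every $i=1,\dots,N$, $$\tau_i\le\frac{1}{\max_{j=1,\dots,n_i}\{\sum_{k=1}^m|[A_i^T]_{jk}|\}+\delta},\qquad \nu_i\le\frac{1}{2d_i+\delta},\qquad \sigma_i\le\frac{1}{\max_{j=1,\dots,m}\{\sum_{k=1}^{n_i}|[A_i]_{jk}|\}+2d_i+\delta}.$$ Then, for the sequences generated by the iteration, each player's local strategy $x_{i,k}$ converges to its corresponding component $x_i^*$ of the variational GNE $\mathbf x^*$ of the game, and the local multipliers $\lambda_{i,k}$ of all players converge to the same multiplier $\lambda^*$, where $(\mathbf x^*,\lambda^* )$ satisfies the KKT conditions of $VI(F,X)$; i.e. $$\lim_{k\to\infty}x_{i,k}=x_i^*,\qquad \lim_{k\to\infty}\lambda_{i,k}=\lambda^*,\qquad \forall i=1,\dots,N.$$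
   Context: **Game.** Players $\mathcal N=\{1,\dots,N\}$; player $i$ chooses $x_i\in\mathbf R^{n_i}$; $n=\sum_i n_i$; $\mathbf x=col(x_1,\dots,x_N)\in\mathbf R^n$ (stacked column vector); $\mathbf x_{-i}$ is the stacked vector of all decisions except $x_i$. Player $i$ has an objective $f_i(x_i,\mathbf x_{-i}):\mathbf R^n\to\mathbf R$ and a private set $\Omega_i\subset\mathbf R^{n_i}$. Let $\Omega=\prod_{i=1}^N\Omega_i$, $A=[A_1,\dots,A_N]\in\mathbf R^{m\times n}$ with $A_i\in\mathbf R^{m\times n_i}$, $b=\sum_{i=1}^N b_i\in\mathbf R^m$ with $b_i\in\mathbf R^m$, and $X=\Omega\cap\{\mathbf x\in\mathbf R^n: A\mathbf x\ge b\}$ (componentwise inequality). Player $i$ solves $\min_{x_i} f_i(x_i,\mathbf x_{-i})$ subject to $x_i\in\Omega_i$, $A_ix_i\ge b-\sum_{j\ne i}A_jx_j$. A GNE is a profile $\mathbf x^*$ such that each $x_i^*$ solves player $i$'s problem given $\mathbf x_{-i}^*$. **Pseudo-gradient, variational GNE, KKT.** $F(\mathbf x)=col(\nabla_{x_1}f_1(x_1,\mathbf x_{-1}),\dots,\nabla_{x_N}f_N(x_N,\mathbf x_{-N}))$. $VI(F,X)$: find $\mathbf x^*\in X$ with $\langle F(\mathbf x^* ),\mathbf x-\mathbf x^*\rangle\ge0$ for all $\mathbf x\in X$. A solution of $VI(F,X)$ is called a variational GNE (it is unique under the assumptions below). The KKT conditions of $VI(F,X)$ for $(\mathbf x^*,\lambda^*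 )$, $\lambda^*\in\mathbf R^m$, are $$\mathbf 0\in\nabla_{x_i}f_i(x_i^*,\mathbf x_{-i}^* )-A_i^T\lambda^*+N_{\Omega_i}(x_i^* ),\ i=1,\dots,N,\qquad \mathbf 0\in(A\mathbf x^*-b)+N_{\mathbf R^m_+}(\lambda^* ),$$ where $N_C$ is the normal cone operator of a closed convex set $C$ ($N_C(x)=\emptyset$ for $x\notin C$), and $\mathbf R^m_+$ is the nonnegative orthant. **Multiplier graph.** $\mathcal G_\lambda$ is a graph on $\mathcal N$ with neighbor sets $\mathcal N_i^\lambda$ ($i\notin\mathcal N_i^\lambda$) and weighted adjacency matrix $W=[w_{ij}]$, $w_{ij}>0$ if $j\in\mathcal N_i^\lambda$ and $w_{ij}=0$ otherwise; $d_i=\sum_{j=1}^Nw_{ij}$. **Assumption 1.** For each $i$, $f_i(x_i,\mathbf x_{-i})$ is differentiable and convex in $x_i$ for every fixed $\mathbf x_{-i}$; $\Omega_i$ is closed and convex; $X$ has nonempty interior. **Assumption 2.** For some $\eta,\theta>0$ and all $\mathbf x,\mathbf y\in\Omega$: $\langle F(\mathbf x)-F(\mathbf y),\mathbf x-\mathbf y\rangle\ge\eta\|\mathbf x-\mathbf y\|_2^2$ and $\|F(\mathbf x)-F(\mathbf y)\|_2\le\theta\|\mathbf x-\mathbf y\|_2$. **Assumption 3.** $\mathcal G_\lambda$ is undirected and connected, and $W=W^T$. **Iteration.** Player $i$ has variables $x_{i,k}\in\mathbf R^{n_i}$, $z_{i,k}\in\mathbf R^m$, $\lambda_{i,k}\in\mathbf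 R^m$ and fixed step-sizes $\tau_i,\nu_i,\sigma_i>0$. $P_C$ denotes Euclidean projection onto $C$. From arbitrary initial values, for $k\ge0$, $$x_{i,k+1}=P_{\Omega_i}\big[x_{i,k}-\tau_i(\nabla_{x_i}f_i(x_{i,k},\mathbf x_{-i,k})-A_i^T\lambda_{i,k})\big],$$ $$z_{i,k+1}=z_{i,k}+\nu_i\sum_{j\in\mathcal N_i^\lambda}w_{ij}(\lambda_{i,k}-\lambda_{j,k}),$$ $$\lambda_{i,k+1}=P_{\mathbf R^m_+}\Big\{\lambda_{i,k}-\sigma_i\Big[2A_ix_{i,k+1}-A_ix_{i,k}-b_i+\sum_{j\in\mathcal N_i^\lambda}w_{ij}(\lambda_{i,k}-\lambda_{j,k})+2\sum_{j\in\mathcal N_i^\lambda}w_{ij}(z_{i,k+1}-z_{j,k+1})-\sum_{j\in\mathcal N_i^\lambda}w_{ij}(z_{i,k}-z_{j,k})\Big]\Big\}.$$ *)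

theory Defs
  imports "HOL-Analysis.Analysis"
begin

text \<open>
  Encoding of the stacked vector. Players form a finite type \<open>'p\<close>, and \<open>real ^ 'n\<close> is the
  space of decision profiles; \<open>own j\<close> is the player who controls coordinate \<open>j\<close>. The space
  of player \<open>i\<close>, of dimension \<open>card {j. own j = i}\<close>, is represented by the subspace
  \<open>strategy_space own i\<close> of \<open>real ^ 'n\<close> of vectors that vanish outside the coordinates of \<open>i\<close>,
  and \<open>x\<^sub>i\<close> by \<open>block own i x\<close>. This embedding preserves inner products, norms,
  closedness, convexity and projections.
\<close>

definition strategy_space :: "('n::finite \<Rightarrow> 'p) \<Rightarrow> 'p \<Rightarrow> (real ^ 'n) set" where
  "strategy_space own i = {v. \<forall>j. own j \<noteq> i \<longrightarrow> v $ j = 0}"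

definition block :: "('n::finite \<Rightarrow> 'p) \<Rightarrow> 'p \<Rightarrow> real ^ 'n \<Rightarrow> real ^ 'n" where
  "block own i x = (\<chi> j. if own j = i then x $ j else 0)"

text \<open>The profile \<open>(u\<^sub>i, x\<^bsub>-i\<^esub>)\<close>.\<close>

definition deviate :: "('n::finite \<Rightarrow> 'p) \<Rightarrow> 'p \<Rightarrow> real ^ 'n \<Rightarrow> real ^ 'n \<Rightarrow> real ^ 'n" where
  "deviate own i u x = (\<chi> j. if own j = i then u $ j else x $ j)"

text \<open>
  The matrix \<open>A\<^sub>i\<close> keeps its position among the columns of \<open>A = [A\<^sub>1, ..., A\<^sub>N]\<close>,
  all other columns being zero; thus \<open>A\<^sub>i x\<^sub>i\<close> is \<open>col_block own i A *v x\<close>, and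
  \<open>transpose (col_block own i A) *v l\<close> lies in \<open>strategy_space own i\<close>.
\<close>

definition col_block :: "('n::finite \<Rightarrow> 'p) \<Rightarrow> 'p \<Rightarrow> real ^ 'n ^ 'm \<Rightarrow> real ^ 'n ^ 'm" where
  "col_block own i A = (\<chi> r j. if own j = i then A $ r $ j else 0)"

definition joint_set ::
    "('n::finite \<Rightarrow> 'p) \<Rightarrow> ('p \<Rightarrow> (real ^ 'n) set) \<Rightarrow> (real ^ 'n) set" where
  "joint_set own \<Omega> = {x. \<forall>i. block own i x \<in> \<Omega> i}"

definition feasible_set ::
    "('n::finite \<Rightarrow> 'p::finite) \<Rightarrow> ('p \<Rightarrow> (real ^ 'n) set) \<Rightarrow> real ^ 'n ^ 'm
      \<Rightarrow> ('p \<Rightarrow> real ^ 'm) \<Rightarrow> (real ^ 'n) set" where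
  "feasible_set own \<Omega> A b =
     joint_set own \<Omega> \<inter> {x. \<forall>r. (A *v x) $ r \<ge> (\<Sum>i\<in>UNIV. b i) $ r}"

text \<open>
  The gradient with respect to \<open>x\<^sub>i\<close>. The differentiated map depends on \<open>u\<close> only through
  its block \<open>i\<close>, so the gradient lies in \<open>strategy_space own i\<close>.
\<close>

definition partial_grad ::
    "('n::finite \<Rightarrow> 'p) \<Rightarrow> 'p \<Rightarrow> (real ^ 'n \<Rightarrow> real) \<Rightarrow> real ^ 'n \<Rightarrow> real ^ 'n" where
  "partial_grad own i g x = (THE D. GDERIV (\<lambda>u. g (deviate own i u x)) x :> D)"

definition pseudo_grad ::
    "('n::finite \<Rightarrow> 'p) \<Rightarrow> ('p \<Rightarrow> real ^ 'n \<Rightarrow> real) \<Rightarrow> real ^ 'n \<Rightarrow> real ^ 'n" where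
  "pseudo_grad own f x = (\<chi> j. partial_grad own (own j) (f (own j)) x $ j)"

definition VI_solution ::
    "('a::real_inner \<Rightarrow> 'a) \<Rightarrow> 'a set \<Rightarrow> 'a \<Rightarrow> bool" where
  "VI_solution F X xs \<longleftrightarrow> xs \<in> X \<and> (\<forall>x\<in>X. F xs \<bullet> (x - xs) \<ge> 0)"

definition variational_GNE ::
    "('n::finite \<Rightarrow> 'p::finite) \<Rightarrow> ('p \<Rightarrow> real ^ 'n \<Rightarrow> real) \<Rightarrow> ('p \<Rightarrow> (real ^ 'n) set)
      \<Rightarrow> real ^ 'n ^ 'm \<Rightarrow> ('p \<Rightarrow> real ^ 'm) \<Rightarrow> real ^ 'n \<Rightarrow> bool" where
  "variational_GNE own f \<Omega> A b xs \<longleftrightarrow>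
     VI_solution (pseudo_grad own f) (feasible_set own \<Omega> A b) xs"

definition normal_cone :: "'a::real_inner set \<Rightarrow> 'a \<Rightarrow> 'a set" where
  "normal_cone C x = (if x \<in> C then {v. \<forall>y\<in>C. v \<bullet> (y - x) \<le> 0} else {})"

definition nonneg_orthant :: "(real ^ 'm) set" where
  "nonneg_orthant = {l. \<forall>r. l $ r \<ge> 0}"

text \<open>
  Intersecting with \<open>strategy_space own i\<close> gives the normal cone of \<open>\<Omega> i\<close> taken inside the
  space of player \<open>i\<close> rather than in all of \<open>real ^ 'n\<close>.
\<close>

definition KKT ::
    "('n::finite \<Rightarrow> 'p::finite) \<Rightarrow> ('p \<Rightarrow> real ^ 'n \<Rightarrow> real) \<Rightarrow> ('p \<Rightarrow> (real ^ 'n) set)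
      \<Rightarrow> real ^ 'n ^ 'm \<Rightarrow> ('p \<Rightarrow> real ^ 'm) \<Rightarrow> real ^ 'n \<Rightarrow> real ^ 'm \<Rightarrow> bool" where
  "KKT own f \<Omega> A b xs ls \<longleftrightarrow>
     (\<forall>i. \<exists>v \<in> normal_cone (\<Omega> i) (block own i xs) \<inter> strategy_space own i.
        0 = partial_grad own i (f i) xs - transpose (col_block own i A) *v ls + v) \<and>
     (\<exists>v \<in> normal_cone nonneg_orthant ls. 0 = (A *v xs - (\<Sum>i\<in>UNIV. b i)) + v)"

definition weighted_graph :: "('p::finite \<Rightarrow> 'p set) \<Rightarrow> real ^ 'p ^ 'p \<Rightarrow> bool" where
  "weighted_graph Nb W \<longleftrightarrow>
     (\<forall>i. i \<notin> Nb i) \<and> (\<forall>i j. if j \<in> Nb i then W $ i $ j > 0 else W $ i $ j = 0)"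

definition undirected_graph :: "('p \<Rightarrow> 'p set) \<Rightarrow> bool" where
  "undirected_graph Nb \<longleftrightarrow> (\<forall>i j. j \<in> Nb i \<longleftrightarrow> i \<in> Nb j)"

definition connected_graph :: "('p \<Rightarrow> 'p set) \<Rightarrow> bool" where
  "connected_graph Nb \<longleftrightarrow> (\<forall>i j. (i, j) \<in> {(p, q). q \<in> Nb p}\<^sup>*)"

definition degree :: "real ^ 'p ^ 'p \<Rightarrow> 'p::finite \<Rightarrow> real" where
  "degree W i = (\<Sum>j\<in>UNIV. W $ i $ j)"

text \<open>
  For a connected graph this is zero only when there is a single player; a bound
  \<open>1 / (2 * max_degree W)\<close> then stands for infinity, not for the value \<open>1 / 0 = 0\<close>.
\<close>

definition max_degree :: "real ^ 'p ^ 'p::finite \<Rightarrow> real" where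
  "max_degree W = (MAX i. degree W i)"

text \<open>
  One round of the algorithm; \<open>closest_point C\<close> is the Euclidean projection onto \<open>C\<close>.
  The block \<open>i\<close> of \<open>x k\<close> is player \<open>i\<close>'s decision; initial values are unconstrained.
\<close>

definition iteration ::
    "('n::finite \<Rightarrow> 'p::finite) \<Rightarrow> ('p \<Rightarrow> real ^ 'n \<Rightarrow> real) \<Rightarrow> ('p \<Rightarrow> (real ^ 'n) set)
      \<Rightarrow> real ^ 'n ^ 'm \<Rightarrow> ('p \<Rightarrow> real ^ 'm) \<Rightarrow> ('p \<Rightarrow> 'p set) \<Rightarrow> real ^ 'p ^ 'p
      \<Rightarrow> ('p \<Rightarrow> real) \<Rightarrow> ('p \<Rightarrow> real) \<Rightarrow> ('p \<Rightarrow> real)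
      \<Rightarrow> (nat \<Rightarrow> real ^ 'n) \<Rightarrow> (nat \<Rightarrow> 'p \<Rightarrow> real ^ 'm) \<Rightarrow> (nat \<Rightarrow> 'p \<Rightarrow> real ^ 'm) \<Rightarrow> bool" where
  "iteration own f \<Omega> A b Nb W \<tau> \<nu> \<sigma> x z l \<longleftrightarrow>
     (\<forall>k i.
        block own i (x (Suc k)) =
          closest_point (\<Omega> i)
            (block own i (x k)
              - \<tau> i *\<^sub>R (partial_grad own i (f i) (x k) - transpose (col_block own i A) *v l k i)) \<and>
        z (Suc k) i = z k i + \<nu> i *\<^sub>R (\<Sum>j\<in>Nb i. W $ i $ j *\<^sub>R (l k i - l k j)) \<and>
        l (Suc k) i =
          closest_point nonneg_orthant
            (l k i - \<sigma> i *\<^sub>R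
              (2 *\<^sub>R (col_block own i A *v x (Suc k)) - col_block own i A *v x k - b i
                + (\<Sum>j\<in>Nb i. W $ i $ j *\<^sub>R (l k i - l k j))
                + 2 *\<^sub>R (\<Sum>j\<in>Nb i. W $ i $ j *\<^sub>R (z (Suc k) i - z (Suc k) j))
                - (\<Sum>j\<in>Nb i. W $ i $ j *\<^sub>R (z k i - z k j)))))"

end

theory Submission imports Defs
begin

text \<open>
  Write \<open>\<Lambda>\<close> for the map \<open>x \<mapsto> col(A\<^sub>1 x\<^sub>1, ..., A\<^sub>N x\<^sub>N)\<close> and \<open>L\<close> for the Laplacian of the
  multiplier graph, acting on tuples of vectors. One round of the algorithm is a forward-backward
  step for a single variational inequality in the space of triples \<open>w = (x, z, l)\<close>. There each
  player holds a copy \<open>l\<^sub>i\<close> of the multiplier, and \<open>z\<close> is the multiplier of the consensus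
  constraint \<open>L l = 0\<close>. The inequality has the operator \<open>G + S\<close>,
  \<open>G(x, z, l) = (F x, 0, L l - b)\<close> and \<open>S(x, z, l) = (-\<Lambda>\<^sup>T l, -L l, \<Lambda> x + L z)\<close>, on the product
  \<open>K\<close> of \<open>\<Omega>\<close>, the whole space and the orthants. The map \<open>S\<close> is linear and skew. A round
  says that, for all \<open>y\<close> in \<open>K\<close>,
  \<open>(P (w\<^sub>k - w\<^bsub>k+1\<^esub>) - G w\<^sub>k - S w\<^bsub>k+1\<^esub>) \<bullet> (y - w\<^bsub>k+1\<^esub>) \<le> 0\<close>,
  where \<open>P\<close> has the inverse step sizes on its diagonal and \<open>\<Lambda>\<close>, \<open>L\<close> and their adjoints off the
  diagonal. The off-diagonal part makes the implicit step computable: in the rows of \<open>x\<close> and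
  \<open>z\<close> it replaces the new multiplier in \<open>S w\<^bsub>k+1\<^esub>\<close> by the old one, and in the row of \<open>l\<close>
  it produces the extrapolations \<open>2 x\<^bsub>k+1\<^esub> - x\<^sub>k\<close> and \<open>2 z\<^bsub>k+1\<^esub> - z\<^sub>k\<close>.

  Two quantitative facts drive the convergence. The step sizes make \<open>P\<close> diagonally dominant with
  margin \<open>\<delta>\<close> (\<open>step_metric_bounded_below\<close>), and \<open>G\<close> is \<open>\<beta>\<close>-cocoercive on \<open>K\<close>
  (\<open>forward_part_cocoercive\<close>). Since \<open>\<delta> > 1 / (2 \<beta>)\<close>, each step decreases the squared
  \<open>P\<close>-distance to every solution by a multiple of the squared step length. Hence the iterates are
  bounded, the steps tend to zero, every cluster point is a solution, and the monotone distance to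
  one cluster point forces the whole sequence to converge to it
  (\<open>preconditioned_forward_backward_converges\<close>).

  It remains to relate solutions in the enlarged space to the game. On a connected graph the kernel
  of \<open>L\<close> consists of the constant tuples, so the copies \<open>l\<^sub>i\<close> of a solution agree, and adding the
  players' rows removes \<open>z\<close> and leaves the KKT conditions
  (\<open>primal_dual_VI_imp_multiplier_pair\<close>). Conversely the range of \<open>L\<close> consists of all tuples
  with sum zero, so \<open>z\<close> can redistribute any split of the coupling constraint among the players
  (\<open>multiplier_pair_imp_primal_dual_VI\<close>). The descent argument presupposes that a solution exists:
  the variational inequality over \<open>X\<close> is solved by Banach's fixed point theorem
  (\<open>strongly_monotone_VI_solvable\<close>), and its multiplier comes from separating convex sets
  (\<open>linear_program_multiplier\<close>).
\<close>

section \<open>Strongly monotone variational inequalities\<close>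

lemma VI_solution_unique:
  assumes "\<And>u v. u \<in> X \<Longrightarrow> v \<in> X \<Longrightarrow> \<eta> * (norm (u - v))\<^sup>2 \<le> (F u - F v) \<bullet> (u - v)"
    and "\<eta> > 0" "VI_solution F X u" "VI_solution F X v"
  shows "u = v"
proof -
  have uv: "u \<in> X" "v \<in> X" and "F u \<bullet> (v - u) \<ge> 0" "F v \<bullet> (u - v) \<ge> 0"
    using assms(3,4) by (auto simp: VI_solution_def)
  then have "(F u - F v) \<bullet> (u - v) \<le> 0"
    by (simp add: inner_diff_left inner_diff_right)
  then have "\<eta> * (norm (u - v))\<^sup>2 \<le> 0"
    using assms(1)[OF uv] by linarith
  then show ?thesis
    using \<open>\<eta> > 0\<close> by (simp add: mult_le_0_iff)
qed

text \<open>
  Solutions are the fixed points of the projected step \<open>u \<mapsto> P\<^sub>X (u - \<gamma> F u)\<close>. Projections do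
  not increase distances, and \<open>\<parallel>d - \<gamma> g\<parallel>\<^sup>2 \<le> (1 - 2 \<gamma> \<eta> + \<gamma>\<^sup>2 \<theta>\<^sup>2) \<parallel>d\<parallel>\<^sup>2\<close> for
  \<open>d = u - v\<close> and \<open>g = F u - F v\<close>; the choice \<open>\<gamma> = \<eta> / \<theta>\<^sup>2\<close> minimizes the factor.
\<close>
lemma strongly_monotone_VI_solvable:
  fixes F :: "'a::euclidean_space \<Rightarrow> 'a"
  assumes "closed X" "convex X" "X \<noteq> {}"
    and mono: "\<And>u v. u \<in> X \<Longrightarrow> v \<in> X \<Longrightarrow> \<eta> * (norm (u - v))\<^sup>2 \<le> (F u - F v) \<bullet> (u - v)"
    and lip: "\<And>u v. u \<in> X \<Longrightarrow> v \<in> X \<Longrightarrow> norm (F u - F v) \<le> \<theta> * norm (u - v)"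
    and "\<eta> > 0" "\<theta> > 0"
  shows "\<exists>xs. VI_solution F X xs"
proof -
  define \<gamma> where "\<gamma> = \<eta> / \<theta>\<^sup>2"
  define T where "T u = closest_point X (u - \<gamma> *\<^sub>R F u)" for u
  \<comment> \<open>The factor \<open>1 - \<eta>\<^sup>2 / \<theta>\<^sup>2\<close> can be negative, but only if \<open>X\<close> is a single point.\<close>
  define c where "c = sqrt (max 0 (1 - \<eta>\<^sup>2 / \<theta>\<^sup>2))"
  have "\<gamma> > 0" using assms by (simp add: \<gamma>_def)
  have c: "0 \<le> c" "c < 1"
    using assms by (auto simp: c_def)
  have TX: "T ` X \<subseteq> X"
    using closest_point_in_set[OF \<open>closed X\<close> \<open>X \<noteq> {}\<close>] by (auto simp: T_def)
  have "dist (T u) (T v) \<le> c * dist u v" if uv: "u \<in> X" "v \<in> X" for u v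
  proof -
    let ?d = "u - v" and ?g = "F u - F v"
    have "(norm (?d - \<gamma> *\<^sub>R ?g))\<^sup>2 = (norm ?d)\<^sup>2 - 2 * \<gamma> * (?g \<bullet> ?d) + \<gamma>\<^sup>2 * (norm ?g)\<^sup>2"
      unfolding power2_norm_eq_inner
      by (simp add: inner_diff_left inner_diff_right inner_commute power2_eq_square algebra_simps)
    also have "\<dots> \<le> (norm ?d)\<^sup>2 - 2 * \<gamma> * (\<eta> * (norm ?d)\<^sup>2) + \<gamma>\<^sup>2 * (\<theta> * norm ?d)\<^sup>2"
      using mono[OF uv] lip[OF uv] \<open>\<gamma> > 0\<close> by (intro add_mono diff_mono mult_left_mono power_mono) auto
    also have "\<dots> = (1 - \<eta>\<^sup>2 / \<theta>\<^sup>2) * (norm ?d)\<^sup>2"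
      using \<open>\<theta> > 0\<close> by (simp add: \<gamma>_def field_simps power2_eq_square)
    also have "\<dots> \<le> (c * norm ?d)\<^sup>2"
      unfolding power_mult_distrib by (intro mult_right_mono) (auto simp: c_def)
    finally have "norm (?d - \<gamma> *\<^sub>R ?g) \<le> c * norm ?d"
      by (rule power2_le_imp_le) (use c in auto)
    moreover have "dist (T u) (T v) \<le> dist (u - \<gamma> *\<^sub>R F u) (v - \<gamma> *\<^sub>R F v)"
      unfolding T_def by (rule closest_point_lipschitz) (use assms in auto)
    ultimately show ?thesis
      by (simp add: dist_norm algebra_simps)
  qed
  then obtain xs where xs: "xs \<in> X" "T xs = xs"
    using Banach_fix[of X c T] assms TX c by (auto simp: complete_eq_closed)
  have "F xs \<bullet> (y - xs) \<ge> 0" if "y \<in> X" for y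
  proof -
    have "(xs - \<gamma> *\<^sub>R F xs - xs) \<bullet> (y - xs) \<le> 0"
      using closest_point_dot[OF \<open>convex X\<close> \<open>closed X\<close> that, of "xs - \<gamma> *\<^sub>R F xs"] xs(2)
      by (simp add: T_def)
    then show ?thesis using \<open>\<gamma> > 0\<close> by (simp add: zero_le_mult_iff)
  qed
  with xs show ?thesis by (auto simp: VI_solution_def)
qed

section \<open>Multipliers by separation\<close>

text \<open>
  Lagrange duality for a linear objective over a convex set \<open>C\<close> cut by linear inequalities. By
  optimality, the convex set \<open>V\<close> of pairs (excess of objective value, violation of constraints) in the
  proof misses the origin. A separating hyperplane supplies the multiplier, and a Slater point
  rules out that the hyperplane is vertical.
\<close>
lemma linear_program_multiplier:
  fixes A :: "real ^ 'n::finite ^ 'm::finite" and d :: "real ^ 'm"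
  assumes "convex C" and x0: "x0 \<in> interior (C \<inter> {x. \<forall>r. d $ r \<le> (A *v x) $ r})"
    and min: "VI_solution (\<lambda>_. c) (C \<inter> {x. \<forall>r. d $ r \<le> (A *v x) $ r}) xs"
  obtains mu where "mu \<in> nonneg_orthant" "mu \<bullet> (A *v xs - d) = 0"
    "VI_solution (\<lambda>_. c - transpose A *v mu) C xs"
proof -
  let ?X = "C \<inter> {x. \<forall>r. d $ r \<le> (A *v x) $ r}"
  have xs: "xs \<in> C" "\<And>r. d $ r \<le> (A *v xs) $ r"
    and opt: "\<And>y. y \<in> ?X \<Longrightarrow> 0 \<le> c \<bullet> (y - xs)"
    using min by (auto simp: VI_solution_def)
  have "x0 \<in> C" using x0 interior_subset by blast
  \<comment> \<open>A constraint with a nonzero row is slack at an interior point.\<close>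
  have slack: "d $ r < (A *v x0) $ r" if "row r A \<noteq> 0" for r
  proof -
    obtain e where e: "e > 0" "cball x0 e \<subseteq> ?X"
      using x0 by (meson mem_interior_cball)
    define t where "t = e / norm (row r A)"
    have "t > 0" using e that by (simp add: t_def)
    have "x0 - t *\<^sub>R row r A \<in> cball x0 e"
      using e that by (simp add: t_def dist_norm)
    then have "d $ r \<le> (A *v (x0 - t *\<^sub>R row r A)) $ r" using e by blast
    also have "\<dots> = (A *v x0) $ r - t * (row r A \<bullet> row r A)"
      by (simp add: matrix_vector_mul_component inner_diff_right row_def vec_nth_inverse)
    also have "\<dots> < (A *v x0) $ r" using that \<open>t > 0\<close> by simp
    finally show ?thesis .
  qed
  \<comment> \<open>Interior points need not be slack where the row of \<open>A\<close> vanishes, but such a constraint holds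
    on all of \<open>C\<close>. Leaving \<open>s $ r\<close> unrestricted there forces the multiplier to vanish at \<open>r\<close>.\<close>
  define V where "V = {(c \<bullet> (x - xs) + t, d - A *v x + s) | x t s.
     x \<in> C \<and> t > 0 \<and> (\<forall>r. row r A \<noteq> 0 \<longrightarrow> s $ r \<ge> 0)}"
  have VI: "(c \<bullet> (x - xs) + t, d - A *v x + s) \<in> V"
    if "x \<in> C" "t > 0" "\<And>r. row r A \<noteq> 0 \<Longrightarrow> s $ r \<ge> 0" for x t s
    unfolding V_def using that by blast
  have "convex V"
  proof (rule convexI)
    fix p q u v assume pq: "p \<in> V" "q \<in> V" and uv: "0 \<le> u" "0 \<le> v" "u + v = (1::real)"
    obtain x t s where p: "p = (c \<bullet> (x - xs) + t, d - A *v x + s)" "x \<in> C" "t > 0"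
      "\<And>r. row r A \<noteq> 0 \<Longrightarrow> s $ r \<ge> 0" using pq(1) by (auto simp: V_def)
    obtain x' t' s' where q: "q = (c \<bullet> (x' - xs) + t', d - A *v x' + s')" "x' \<in> C" "t' > 0"
      "\<And>r. row r A \<noteq> 0 \<Longrightarrow> s' $ r \<ge> 0" using pq(2) by (auto simp: V_def)
    have v: "v = 1 - u" using uv by simp
    have "(c \<bullet> ((u *\<^sub>R x + v *\<^sub>R x') - xs) + (u * t + v * t'),
        d - A *v (u *\<^sub>R x + v *\<^sub>R x') + (u *\<^sub>R s + v *\<^sub>R s')) \<in> V"
    proof (rule VI)
      show "u *\<^sub>R x + v *\<^sub>R x' \<in> C" using \<open>convex C\<close> p q uv by (simp add: convex_def)
      show "0 < u * t + v * t'" using p q uv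
        by (cases "u = 0") (auto intro: add_pos_nonneg)
    qed (use p q uv in auto)
    also have "(c \<bullet> ((u *\<^sub>R x + v *\<^sub>R x') - xs) + (u * t + v * t'),
        d - A *v (u *\<^sub>R x + v *\<^sub>R x') + (u *\<^sub>R s + v *\<^sub>R s')) = u *\<^sub>R p + v *\<^sub>R q"
      unfolding p(1) q(1) v
      by (simp add: algebra_simps inner_diff_right inner_add_right matrix_vector_right_distrib
          matrix_vector_mult_diff_distrib matrix_vector_mult_scaleR)
    finally show "u *\<^sub>R p + v *\<^sub>R q \<in> V" .
  qed
  moreover have "0 \<notin> V"
  proof
    assume "0 \<in> V"
    then obtain x t s where x: "x \<in> C" "t > 0" "\<And>r. row r A \<noteq> 0 \<Longrightarrow> s $ r \<ge> 0"
      and 0: "c \<bullet> (x - xs) + t = 0" "d - A *v x + s = 0"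
      by (auto simp: V_def zero_prod_def)
    have "d $ r \<le> (A *v x) $ r" for r
    proof (cases "row r A = 0")
      case True
      then have "(A *v x) $ r = (A *v xs) $ r"
        by (simp add: matrix_vector_mult_def row_def vec_eq_iff)
      then show ?thesis using xs by simp
    next
      case False
      then show ?thesis using x(3)[OF False] arg_cong[OF 0(2), of "\<lambda>v. v $ r"] by simp
    qed
    then show False using opt[of x] x 0 by simp
  qed
  ultimately obtain a where a: "a \<noteq> 0" "\<And>p. p \<in> V \<Longrightarrow> 0 \<le> a \<bullet> p"
    using separating_hyperplane_set_0 by metis
  obtain m0 m where am: "a = (m0, m)" by (cases a)
  have sep: "0 \<le> m0 * (c \<bullet> (x - xs) + t) + m \<bullet> (d - A *v x + s)"
    if "x \<in> C" "t > 0" "\<And>r. row r A \<noteq> 0 \<Longrightarrow> s $ r \<ge> 0" for x t s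
    using a(2)[OF VI[OF that]] by (simp add: am)
  have unbounded: False if "\<And>t. t > 0 \<Longrightarrow> 0 \<le> p + t * q" "q < 0" for p q :: real
  proof -
    define t where "t = (\<bar>p\<bar> + 1) / - q"
    have "t > 0" "t * q = - (\<bar>p\<bar> + 1)" using that(2) by (auto simp: t_def field_simps)
    then show False using that(1)[of t] by linarith
  qed
  have m0: "m0 \<ge> 0"
  proof (rule ccontr)
    assume "\<not> ?thesis"
    then have "m0 < 0" by simp
    have "0 \<le> m \<bullet> (d - A *v xs) + t * m0" if "t > 0" for t
      using sep[of xs t 0] xs that by (simp add: mult.commute[of t] add.commute)
    then show False using \<open>m0 < 0\<close> by (rule unbounded)
  qed
  \<comment> \<open>The coordinate \<open>s $ r\<close> may run along the ray of \<open>q\<close>, so the functional cannot decrease there.\<close>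
  have mr: "0 \<le> q * m $ r" if "row r A \<noteq> 0 \<Longrightarrow> q \<ge> 0" for r q
  proof (rule ccontr)
    assume "\<not> ?thesis"
    then have neg: "q * m $ r < 0" by simp
    have "0 \<le> (m0 + m \<bullet> (d - A *v xs)) + t * (q * m $ r)" if "t > 0" for t
    proof -
      have "0 \<le> ((t * q) *\<^sub>R axis r (1::real)) $ i" if "row i A \<noteq> 0" for i
        using \<open>t > 0\<close> that \<open>row r A \<noteq> 0 \<Longrightarrow> q \<ge> 0\<close> by (cases "i = r") (auto simp: axis_def)
      from sep[of xs 1, OF _ _ this] show ?thesis
        using xs(1) by (simp add: inner_add_right inner_axis)
    qed
    then show False using neg by (rule unbounded)
  qed
  have m_nonneg: "0 \<le> m $ r" for r using mr[of r 1] by simp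
  have m_zero: "m $ r = 0" if "row r A = 0" for r
    using mr[of r "-1"] mr[of r 1] that by simp
  \<comment> \<open>The hyperplane is not vertical: at \<open>x0\<close> all constraints that carry a multiplier are slack.\<close>
  have "m0 \<noteq> 0"
  proof
    assume "m0 = 0"
    have "0 \<le> m \<bullet> (d - A *v x0)" using sep[of x0 1 0] \<open>x0 \<in> C\<close> \<open>m0 = 0\<close> by simp
    moreover have "m $ r * (d - A *v x0) $ r \<le> 0" for r
      using m_zero[of r] m_nonneg[of r] slack[of r]
      by (cases "row r A = 0") (auto simp: mult_le_0_iff)
    ultimately have "m $ r * (d - A *v x0) $ r = 0" for r
      using sum_nonneg_0[of UNIV "\<lambda>r. - (m $ r * (d - A *v x0) $ r)"]
        sum_nonpos[of UNIV "\<lambda>r. m $ r * (d - A *v x0) $ r"]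
      by (force simp: inner_vec_def sum_negf)
    then have "m $ r = 0" for r
      using m_zero[of r] slack[of r] by (cases "row r A = 0") force+
    then show False using a(1) \<open>m0 = 0\<close> by (simp add: am vec_eq_iff zero_prod_def)
  qed
  with m0 have m0: "m0 > 0" by simp
  define mu where "mu = m /\<^sub>R m0"
  have mu: "mu \<in> nonneg_orthant" using m_nonneg m0 by (simp add: mu_def nonneg_orthant_def)
  have sep': "0 \<le> c \<bullet> (x - xs) + mu \<bullet> (d - A *v x)" if "x \<in> C" for x
  proof (rule field_le_epsilon)
    fix t :: real assume "t > 0"
    have "0 \<le> (m0 * (c \<bullet> (x - xs) + t) + m \<bullet> (d - A *v x)) / m0"
      using sep[OF that \<open>t > 0\<close>, of 0] m0 by simp
    then show "0 \<le> c \<bullet> (x - xs) + mu \<bullet> (d - A *v x) + t"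
      using m0 by (simp add: mu_def field_simps)
  qed
  have "mu \<bullet> (d - A *v xs) \<le> 0"
    using mu xs by (auto simp: inner_vec_def nonneg_orthant_def mult_le_0_iff intro!: sum_nonpos)
  then have compl: "mu \<bullet> (A *v xs - d) = 0"
    using sep'[OF xs(1)] by (simp add: inner_diff_right)
  have "0 \<le> (c - transpose A *v mu) \<bullet> (y - xs)" if "y \<in> C" for y
    using sep'[OF that] compl
    by (simp add: inner_diff_left inner_diff_right dot_lmul_matrix)
  then show ?thesis
    using that mu compl xs by (auto simp: VI_solution_def)
qed

section \<open>Forward-backward splitting in a preconditioned metric\<close>

text \<open>
  Each step evaluates the cocoercive part \<open>G\<close> at the old point and the skew part \<open>S\<close> together with
  the constraint at the new one. Comparing a step with a solution \<open>q\<close>, the skew part cancels. The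
  part \<open>G\<close> costs at most \<open>\<parallel>e\<parallel>\<^sup>2 / (4 \<beta>)\<close> for the step \<open>e\<close>, by cocoercivity and Young's
  inequality. This costs \<open>\<parallel>e\<parallel>\<^sup>2 / (2 \<beta>)\<close> in the squared \<open>P\<close>-distance to \<open>q\<close>, against the
  gain \<open>P e \<bullet> e \<ge> \<delta> \<parallel>e\<parallel>\<^sup>2\<close>.
\<close>
theorem preconditioned_forward_backward_converges:
  fixes G S P :: "'a::euclidean_space \<Rightarrow> 'a"
  assumes "closed K" and "\<beta> > 0"
    and coco: "\<And>u v. u \<in> K \<Longrightarrow> v \<in> K \<Longrightarrow> \<beta> * (norm (G u - G v))\<^sup>2 \<le> (G u - G v) \<bullet> (u - v)"
    and S: "linear S" and skew: "\<And>u. S u \<bullet> u = 0"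
    and P: "linear P" and sym: "\<And>u v. P u \<bullet> v = u \<bullet> P v"
    and pos: "\<And>u. \<delta> * (norm u)\<^sup>2 \<le> P u \<bullet> u"
    and \<delta>: "\<delta> > 1 / (2 * \<beta>)"
    and solvable: "VI_solution (\<lambda>u. G u + S u) K q0"
    and wK: "\<And>k. w k \<in> K"
    and step: "\<And>k y. y \<in> K \<Longrightarrow>
      (P (w k - w (Suc k)) - G (w k) - S (w (Suc k))) \<bullet> (y - w (Suc k)) \<le> 0"
  shows "\<exists>q. VI_solution (\<lambda>u. G u + S u) K q \<and> w \<longlonglongrightarrow> q"
proof -
  have "\<delta> > 0" using \<delta> \<open>\<beta> > 0\<close> by (smt (verit) divide_pos_pos)
  define \<epsilon> where "\<epsilon> = \<delta> - 1 / (2 * \<beta>)"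
  have "\<epsilon> > 0" using \<delta> by (simp add: \<epsilon>_def)
  have descent: "P (w (Suc k) - q) \<bullet> (w (Suc k) - q) + \<epsilon> * (norm (w k - w (Suc k)))\<^sup>2
      \<le> P (w k - q) \<bullet> (w k - q)" if q: "VI_solution (\<lambda>u. G u + S u) K q" for q k
  proof -
    define d e g where "d = w k - q" and "e = w k - w (Suc k)" and "g = G (w k) - G q"
    have de: "w (Suc k) - q = d - e" by (simp add: d_def e_def)
    have "q \<in> K" using q by (simp add: VI_solution_def)
    have "(P e - G (w k) - S (w (Suc k))) \<bullet> (q - w (Suc k)) \<le> 0"
      using step[OF \<open>q \<in> K\<close>] by (simp add: e_def)
    moreover have "0 \<le> (G q + S q) \<bullet> (w (Suc k) - q)"
      using q wK by (simp add: VI_solution_def)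
    moreover have "(S (w (Suc k)) - S q) \<bullet> (w (Suc k) - q) = 0"
      using skew[of "w (Suc k) - q"] by (simp add: linear_diff[OF S])
    ultimately have "g \<bullet> (w (Suc k) - q) \<le> P e \<bullet> (w (Suc k) - q)"
      by (simp add: g_def inner_diff_left inner_diff_right inner_add_left algebra_simps)
    then have 1: "g \<bullet> (d - e) \<le> P e \<bullet> (d - e)" by (simp add: de)
    have 2: "\<beta> * (norm g)\<^sup>2 \<le> g \<bullet> d"
      unfolding g_def d_def using coco[OF wK \<open>q \<in> K\<close>] .
    \<comment> \<open>Young's inequality, weighted so that the term in \<open>g\<close> is absorbed by cocoercivity.\<close>
    have "0 \<le> (norm ((2 * \<beta>) *\<^sub>R g - e))\<^sup>2" by simp
    also have "\<dots> = 4 * \<beta> * (\<beta> * (norm g)\<^sup>2 - g \<bullet> e + (norm e)\<^sup>2 / (4 * \<beta>))"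
      unfolding power2_norm_eq_inner using \<open>\<beta> > 0\<close>
      by (simp add: inner_diff_left inner_diff_right inner_commute algebra_simps)
    finally have 3: "g \<bullet> e \<le> \<beta> * (norm g)\<^sup>2 + (norm e)\<^sup>2 / (4 * \<beta>)"
      using \<open>\<beta> > 0\<close> by (simp add: zero_le_mult_iff)
    have "P (d - e) \<bullet> (d - e) = P d \<bullet> d - 2 * (P e \<bullet> (d - e)) - P e \<bullet> e"
      using sym[of d e] by (simp add: linear_diff[OF P] inner_diff_left inner_diff_right inner_commute)
    also have "\<dots> \<le> P d \<bullet> d + (norm e)\<^sup>2 / (2 * \<beta>) - \<delta> * (norm e)\<^sup>2"
      using 1 2 3 pos[of e] by (simp add: inner_diff_right)
    finally show ?thesis
      unfolding de d_def[symmetric] e_def[symmetric] by (simp add: \<epsilon>_def algebra_simps)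
  qed
  have nonneg: "P u \<bullet> u \<ge> 0" for u
    using pos[of u] \<open>\<delta> > 0\<close> by (smt (verit) mult_nonneg_nonneg zero_le_power2)
  have dec: "decseq (\<lambda>k. P (w k - q) \<bullet> (w k - q))" if "VI_solution (\<lambda>u. G u + S u) K q" for q
    using descent[OF that] \<open>\<epsilon> > 0\<close>
    by (intro decseq_SucI) (smt (verit) mult_nonneg_nonneg zero_le_power2)
  let ?V = "\<lambda>k. P (w k - q0) \<bullet> (w k - q0)"
  have "bounded (range w)"
  proof -
    have "norm (w k - q0) \<le> sqrt (?V 0 / \<delta>)" for k
    proof (rule real_le_rsqrt)
      have "\<delta> * (norm (w k - q0))\<^sup>2 \<le> ?V 0"
        using pos[of "w k - q0"] decseqD[OF dec[OF solvable], of 0 k] by simp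
      then show "(norm (w k - q0))\<^sup>2 \<le> ?V 0 / \<delta>"
        using \<open>\<delta> > 0\<close> by (simp add: field_simps)
    qed
    then show ?thesis
      by (intro bounded_subset[OF bounded_cball[of q0 "sqrt (?V 0 / \<delta>)"]])
         (auto simp: dist_norm norm_minus_commute)
  qed
  then obtain q r where r: "strict_mono r" "(w \<circ> r) \<longlonglongrightarrow> q"
    using bounded_imp_convergent_subsequence by blast
  have "convergent ?V"
    using decseq_convergent[OF dec[OF solvable], of 0] nonneg by (metis convergentI)
  then obtain V where V: "?V \<longlonglongrightarrow> V" by (auto simp: convergent_def)
  have "(\<lambda>k. w k - w (Suc k)) \<longlonglongrightarrow> 0"
  proof -
    have "(\<lambda>k. (?V k - ?V (Suc k)) / \<epsilon>) \<longlonglongrightarrow> (V - V) / \<epsilon>"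
      by (intro tendsto_intros V LIMSEQ_Suc) (use \<open>\<epsilon> > 0\<close> in auto)
    then have lim: "(\<lambda>k. (?V k - ?V (Suc k)) / \<epsilon>) \<longlonglongrightarrow> 0" by simp
    have "norm ((norm (w k - w (Suc k)))\<^sup>2) \<le> (?V k - ?V (Suc k)) / \<epsilon>" for k
      using descent[OF solvable, of k] \<open>\<epsilon> > 0\<close> by (simp add: pos_le_divide_eq mult.commute)
    then have "(\<lambda>k. (norm (w k - w (Suc k)))\<^sup>2) \<longlonglongrightarrow> 0"
      by (rule Lim_null_comparison[OF always_eventually[rule_format] lim])
    then show ?thesis using tendsto_real_sqrt[of _ 0] by (force simp: tendsto_norm_zero_iff)
  qed
  then have e0: "(\<lambda>k. w (r k) - w (Suc (r k))) \<longlonglongrightarrow> 0"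
    using LIMSEQ_subseq_LIMSEQ[OF _ r(1)] by (fastforce simp: o_def)
  have wr: "(\<lambda>k. w (r k)) \<longlonglongrightarrow> q" using r(2) by (simp add: o_def)
  have wSr: "(\<lambda>k. w (Suc (r k))) \<longlonglongrightarrow> q"
    using tendsto_diff[OF wr e0] by simp
  have "q \<in> K" using closed_sequentially[OF \<open>closed K\<close> _ wr] wK by blast
  have Gr: "(\<lambda>k. G (w (r k))) \<longlonglongrightarrow> G q"
  proof -
    have "norm (G (w (r k)) - G q) \<le> norm (w (r k) - q) / \<beta>" for k
    proof -
      let ?g = "G (w (r k)) - G q"
      have "\<beta> * (norm ?g)\<^sup>2 \<le> norm ?g * norm (w (r k) - q)"
        using coco[OF wK \<open>q \<in> K\<close>, of "r k"] norm_cauchy_schwarz order_trans by blast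
      then show ?thesis using \<open>\<beta> > 0\<close>
        by (cases "norm ?g = 0") (auto simp: field_simps power2_eq_square)
    qed
    moreover have "(\<lambda>k. norm (w (r k) - q) / \<beta>) \<longlonglongrightarrow> 0"
      using tendsto_divide[OF tendsto_norm[OF tendsto_diff[OF wr tendsto_const[of q]]] tendsto_const[of \<beta>]]
        \<open>\<beta> > 0\<close> by simp
    ultimately have "(\<lambda>k. G (w (r k)) - G q) \<longlonglongrightarrow> 0"
      by (rule Lim_null_comparison[OF always_eventually[rule_format]])
    then show ?thesis by (simp add: LIM_zero_iff)
  qed
  have lims: "(\<lambda>k. P (w (r k) - w (Suc (r k)))) \<longlonglongrightarrow> P 0" "(\<lambda>k. S (w (Suc (r k)))) \<longlonglongrightarrow> S q"
    using bounded_linear.tendsto e0 wSr P S by (blast dest: linear_conv_bounded_linear[THEN iffD1])+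
  have q: "VI_solution (\<lambda>u. G u + S u) K q"
  proof -
    have "0 \<le> (G q + S q) \<bullet> (y - q)" if "y \<in> K" for y
    proof -
      have "(\<lambda>k. (P (w (r k) - w (Suc (r k))) - G (w (r k)) - S (w (Suc (r k)))) \<bullet> (y - w (Suc (r k))))
          \<longlonglongrightarrow> (P 0 - G q - S q) \<bullet> (y - q)"
        by (intro tendsto_intros lims Gr wSr)
      then have "(P 0 - G q - S q) \<bullet> (y - q) \<le> 0"
        using step[OF that] by (intro LIMSEQ_le_const2) auto
      then show ?thesis
        by (simp add: linear_0[OF P] inner_diff_left inner_add_left)
    qed
    then show ?thesis using \<open>q \<in> K\<close> by (simp add: VI_solution_def)
  qed
  \<comment> \<open>The descent now applies to the cluster point itself: its distance decreases, and vanishes along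
    the subsequence, hence vanishes in the limit.\<close>
  let ?U = "\<lambda>k. P (w k - q) \<bullet> (w k - q)"
  have "(\<lambda>k. P (w (r k) - q)) \<longlonglongrightarrow> P (q - q)"
    using P by (intro bounded_linear.tendsto[of P] tendsto_intros wr)
      (simp add: linear_conv_bounded_linear)
  then have Ur: "(?U \<circ> r) \<longlonglongrightarrow> 0"
    using tendsto_inner[OF _ tendsto_diff[OF wr tendsto_const[of q]]] by (force simp: o_def)
  obtain U where U: "?U \<longlonglongrightarrow> U"
    using decseq_convergent[OF dec[OF q], of 0] nonneg by metis
  have "U = 0"
    using LIMSEQ_unique[OF LIMSEQ_subseq_LIMSEQ[OF U r(1)] Ur] .
  then have lim: "(\<lambda>k. ?U k / \<delta>) \<longlonglongrightarrow> 0" using tendsto_divide[OF U tendsto_const[of \<delta>]] \<open>\<delta> > 0\<close> by simp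
  have "norm ((norm (w k - q))\<^sup>2) \<le> ?U k / \<delta>" for k
    using pos[of "w k - q"] \<open>\<delta> > 0\<close> by (simp add: pos_le_divide_eq mult.commute)
  then have "(\<lambda>k. (norm (w k - q))\<^sup>2) \<longlonglongrightarrow> 0"
    by (rule Lim_null_comparison[OF always_eventually[rule_format] lim])
  then have "(\<lambda>k. norm (w k - q)) \<longlonglongrightarrow> 0" using tendsto_real_sqrt[of _ 0] by force
  then have "w \<longlonglongrightarrow> q" by (simp add: tendsto_norm_zero_iff LIM_zero_iff)
  with q show ?thesis by blast
qed

section \<open>The weighted graph Laplacian\<close>

definition laplacian :: "real ^ 'p ^ 'p \<Rightarrow> 'a::real_vector ^ 'p::finite \<Rightarrow> 'a ^ 'p" where
  "laplacian W u = (\<chi> i. \<Sum>j\<in>UNIV. W $ i $ j *\<^sub>R (u $ i - u $ j))"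

lemma linear_laplacian: "linear (laplacian W)"
  by (intro linearI)
    (simp_all add: laplacian_def vec_eq_iff scaleR_sum_right sum.distrib[symmetric] algebra_simps)

text \<open>
  The Dirichlet form of the graph. Symmetry, the kernel and both norm estimates below are read off
  from this sum over edges; each edge occurs in both orientations, hence the factor 2.
\<close>
lemma laplacian_inner:
  fixes u v :: "'a::real_inner ^ 'p::finite"
  assumes sym: "\<And>i j. W $ i $ j = W $ j $ i"
  shows "2 * (laplacian W u \<bullet> v) =
    (\<Sum>i\<in>UNIV. \<Sum>j\<in>UNIV. W $ i $ j * ((u $ i - u $ j) \<bullet> (v $ i - v $ j)))"
proof -
  have L: "laplacian W u \<bullet> v = (\<Sum>i\<in>UNIV. \<Sum>j\<in>UNIV. W $ i $ j * ((u $ i - u $ j) \<bullet> v $ i))"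
    by (simp add: laplacian_def inner_vec_def inner_sum_left)
  also have "\<dots> = (\<Sum>i\<in>UNIV. \<Sum>j\<in>UNIV. W $ i $ j * ((u $ j - u $ i) \<bullet> v $ j))"
    by (subst sum.swap) (simp add: sym)
  finally have "2 * (laplacian W u \<bullet> v) =
    (\<Sum>i\<in>UNIV. \<Sum>j\<in>UNIV. W $ i $ j * ((u $ i - u $ j) \<bullet> v $ i) + W $ i $ j * ((u $ j - u $ i) \<bullet> v $ j))"
    using L by (simp add: sum.distrib)
  then show ?thesis by (simp add: inner_diff_left inner_diff_right algebra_simps)
qed

lemma laplacian_self_adjoint:
  fixes u v :: "'a::real_inner ^ 'p::finite"
  assumes "\<And>i j. W $ i $ j = W $ j $ i"
  shows "laplacian W u \<bullet> v = u \<bullet> laplacian W v"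
  using laplacian_inner[OF assms, of u v] laplacian_inner[OF assms, of v u]
  by (simp add: inner_commute)

lemma sum_laplacian:
  fixes u :: "'a::real_vector ^ 'p::finite"
  assumes sym: "\<And>i j. W $ i $ j = W $ j $ i"
  shows "(\<Sum>i\<in>UNIV. laplacian W u $ i) = 0"
proof -
  have "(\<Sum>i\<in>UNIV. \<Sum>j\<in>UNIV. W $ i $ j *\<^sub>R u $ j) = (\<Sum>i\<in>UNIV. \<Sum>j\<in>UNIV. W $ i $ j *\<^sub>R u $ i)"
    by (subst sum.swap) (simp add: sym)
  then show ?thesis by (simp add: laplacian_def scaleR_diff_right sum_subtractf)
qed

text \<open>
  The Dirichlet form of \<open>u\<close> vanishes, so \<open>u\<close> agrees at the ends of every edge, and then along
  every path.
\<close>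
lemma laplacian_kernel:
  fixes u :: "'a::real_inner ^ 'p::finite"
  assumes sym: "\<And>i j. W $ i $ j = W $ j $ i" and nonneg: "\<And>i j. W $ i $ j \<ge> 0"
    and adj: "\<And>i j. j \<in> Nb i \<Longrightarrow> W $ i $ j > 0" and "connected_graph Nb"
    and 0: "laplacian W u = 0"
  shows "u $ i = u $ j"
proof -
  have "(\<Sum>i\<in>UNIV. \<Sum>j\<in>UNIV. W $ i $ j * ((u $ i - u $ j) \<bullet> (u $ i - u $ j))) = 0"
    using laplacian_inner[OF sym, of u u] 0 by simp
  then have "W $ i $ j * ((u $ i - u $ j) \<bullet> (u $ i - u $ j)) = 0" for i j
    using nonneg by (simp add: sum_nonneg_eq_0_iff sum_nonneg)
  then have edge: "u $ i = u $ j" if "j \<in> Nb i" for i j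
    using adj[OF that] by (metis inner_eq_zero_iff less_irrefl mult_eq_0_iff right_minus_eq)
  have "(i, j) \<in> {(p, q). q \<in> Nb p}\<^sup>*"
    using \<open>connected_graph Nb\<close> by (simp add: connected_graph_def)
  then show ?thesis
    by (induction rule: rtrancl_induct) (use edge in auto)
qed

text \<open>
  The Laplacian is self-adjoint, so its range is the orthogonal complement of its kernel, the constant
  tuples.
\<close>
lemma laplacian_range:
  fixes v :: "'a::euclidean_space ^ 'p::finite"
  assumes sym: "\<And>i j. W $ i $ j = W $ j $ i" and nonneg: "\<And>i j. W $ i $ j \<ge> 0"
    and adj: "\<And>i j. j \<in> Nb i \<Longrightarrow> W $ i $ j > 0" and conn: "connected_graph Nb"
    and v: "(\<Sum>i\<in>UNIV. v $ i) = 0"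
  shows "\<exists>u. laplacian W u = v"
proof -
  let ?L = "laplacian W :: 'a ^ 'p \<Rightarrow> 'a ^ 'p"
  have "adjoint ?L = ?L"
    by (rule adjoint_unique) (simp add: laplacian_self_adjoint[OF sym])
  then have "range ?L = (?L -` {0})\<^sup>\<bottom>"
    using ker_orthogonal_comp_adjoint[OF linear_laplacian, of W]
      orthogonal_comp_self[OF linear_subspace_image[OF linear_laplacian subspace_UNIV]] by metis
  moreover have "v \<in> (?L -` {0})\<^sup>\<bottom>"
  proof -
    have "u \<bullet> v = 0" if "?L u = 0" for u
    proof -
      fix k
      have "u $ i \<bullet> v $ i = u $ k \<bullet> v $ i" for i
        using laplacian_kernel[OF sym nonneg adj conn that, of i k] by simp
      then have "u \<bullet> v = u $ k \<bullet> (\<Sum>i\<in>UNIV. v $ i)"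
        by (simp only: inner_vec_def inner_sum_right)
      then show ?thesis by (simp add: v)
    qed
    then show ?thesis by (auto simp: orthogonal_comp_def orthogonal_def)
  qed
  ultimately show ?thesis by (metis imageE)
qed

text \<open>
  Cauchy-Schwarz with weights \<open>W $ i $ j\<close> bounds the squared norm of each component of \<open>L u\<close> by \<open>D\<close> times the
  energy of the edges at \<open>i\<close>.
\<close>
lemma laplacian_cocoercive:
  fixes u :: "'a::real_inner ^ 'p::finite"
  assumes sym: "\<And>i j. W $ i $ j = W $ j $ i" and nonneg: "\<And>i j. W $ i $ j \<ge> 0"
    and deg: "\<And>i. degree W i \<le> D"
  shows "(norm (laplacian W u))\<^sup>2 \<le> 2 * D * (laplacian W u \<bullet> u)"
proof -
  have row: "(norm (laplacian W u $ i))\<^sup>2 \<le> D * (\<Sum>j\<in>UNIV. W $ i $ j * (norm (u $ i - u $ j))\<^sup>2)" for i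
  proof -
    have "norm (laplacian W u $ i) \<le> (\<Sum>j\<in>UNIV. W $ i $ j * norm (u $ i - u $ j))"
      using norm_sum[of "\<lambda>j. W $ i $ j *\<^sub>R (u $ i - u $ j)" UNIV] nonneg
      by (simp add: laplacian_def)
    also have "\<dots> = (\<Sum>j\<in>UNIV. sqrt (W $ i $ j) * (sqrt (W $ i $ j) * norm (u $ i - u $ j)))"
      using nonneg by (simp add: mult.assoc[symmetric])
    finally have "(norm (laplacian W u $ i))\<^sup>2
        \<le> (\<Sum>j\<in>UNIV. sqrt (W $ i $ j) * (sqrt (W $ i $ j) * norm (u $ i - u $ j)))\<^sup>2"
      by (intro power_mono) auto
    also have "\<dots> \<le> (\<Sum>j\<in>UNIV. (sqrt (W $ i $ j))\<^sup>2) * (\<Sum>j\<in>UNIV. (sqrt (W $ i $ j) * norm (u $ i - u $ j))\<^sup>2)"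
      by (rule Cauchy_Schwarz_ineq_sum)
    also have "\<dots> = degree W i * (\<Sum>j\<in>UNIV. W $ i $ j * (norm (u $ i - u $ j))\<^sup>2)"
      using nonneg by (simp add: power_mult_distrib degree_def)
    also have "\<dots> \<le> D * (\<Sum>j\<in>UNIV. W $ i $ j * (norm (u $ i - u $ j))\<^sup>2)"
      using deg nonneg by (intro mult_right_mono sum_nonneg) auto
    finally show ?thesis .
  qed
  have "(norm (laplacian W u))\<^sup>2 = (\<Sum>i\<in>UNIV. (norm (laplacian W u $ i))\<^sup>2)"
    by (simp add: power2_norm_eq_inner inner_vec_def)
  also have "\<dots> \<le> (\<Sum>i\<in>UNIV. D * (\<Sum>j\<in>UNIV. W $ i $ j * (norm (u $ i - u $ j))\<^sup>2))"
    by (intro sum_mono row)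
  also have "\<dots> = D * (2 * (laplacian W u \<bullet> u))"
    unfolding laplacian_inner[OF sym] by (simp add: sum_distrib_left power2_norm_eq_inner)
  finally show ?thesis by simp
qed

text \<open>
  The contribution of \<open>L\<close> to the diagonal dominance of the step metric: off-diagonal blocks
  that couple \<open>u\<close> and \<open>v\<close> are absorbed by the diagonal entries \<open>2 * degree W i\<close>.
\<close>
lemma laplacian_cross_term_bound:
  fixes u v :: "'a::real_inner ^ 'p::finite"
  assumes sym: "\<And>i j. W $ i $ j = W $ j $ i" and nonneg: "\<And>i j. W $ i $ j \<ge> 0"
  shows "- (\<Sum>i\<in>UNIV. 2 * degree W i * ((norm (u $ i))\<^sup>2 + (norm (v $ i))\<^sup>2)) \<le> 2 * (laplacian W u \<bullet> v)"
proof -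
  let ?n = "\<lambda>i. (norm (u $ i))\<^sup>2 + (norm (v $ i))\<^sup>2"
  have pair: "- (?n i + ?n j) \<le> (u $ i - u $ j) \<bullet> (v $ i - v $ j)" for i j
  proof -
    let ?a = "u $ i" and ?b = "u $ j" and ?c = "v $ i" and ?d = "v $ j"
    \<comment> \<open>These three squares add up to twice the difference of the two sides.\<close>
    have "0 \<le> (norm (?a - ?b + (?c - ?d)))\<^sup>2 + (norm (?a + ?b))\<^sup>2 + (norm (?c + ?d))\<^sup>2"
      by simp
    then show ?thesis
      unfolding power2_norm_eq_inner
      by (simp add: inner_diff_left inner_diff_right inner_add_left inner_add_right inner_commute)
  qed
  have "(\<Sum>i\<in>UNIV. \<Sum>j\<in>UNIV. W $ i $ j * ?n j) = (\<Sum>i\<in>UNIV. \<Sum>j\<in>UNIV. W $ i $ j * ?n i)"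
    by (subst sum.swap) (simp add: sym)
  then have "(\<Sum>i\<in>UNIV. \<Sum>j\<in>UNIV. W $ i $ j * (?n i + ?n j)) = 2 * (\<Sum>i\<in>UNIV. \<Sum>j\<in>UNIV. W $ i $ j * ?n i)"
    by (simp only: distrib_left[of _ "?n _"] sum.distrib mult_2)
  also have "\<dots> = (\<Sum>i\<in>UNIV. 2 * degree W i * ?n i)"
    by (simp only: degree_def sum_distrib_left sum_distrib_right mult.assoc)
  finally have "(\<Sum>i\<in>UNIV. 2 * degree W i * ?n i) = (\<Sum>i\<in>UNIV. \<Sum>j\<in>UNIV. W $ i $ j * (?n i + ?n j))" ..
  then have "- (\<Sum>i\<in>UNIV. 2 * degree W i * ?n i) = (\<Sum>i\<in>UNIV. \<Sum>j\<in>UNIV. W $ i $ j * - (?n i + ?n j))"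
    by (simp only: mult_minus_right sum_negf)
  also have "\<dots> \<le> 2 * (laplacian W u \<bullet> v)"
    unfolding laplacian_inner[OF sym] by (intro sum_mono mult_left_mono pair nonneg)
  finally show ?thesis .
qed

section \<open>Blocks of a decision profile\<close>

lemma block_component [simp]: "block own i v $ j = (if own j = i then v $ j else 0)"
  by (simp add: block_def)

lemma linear_block: "linear (block own i)"
  by (intro linearI) (auto simp: vec_eq_iff)

lemma inner_eq_sum_blocks:
  fixes own :: "'n::finite \<Rightarrow> 'p::finite"
  shows "u \<bullet> v = (\<Sum>i\<in>UNIV. block own i u \<bullet> block own i v)"
  by (simp add: inner_vec_def if_distrib[of "\<lambda>t. t * _"] sum.swap[of _ UNIV UNIV] cong: if_cong)

lemma inner_block: "block own i u \<bullet> v = block own i u \<bullet> block own i v"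
  by (auto simp: inner_vec_def intro!: sum.cong)

lemma closed_joint_set:
  assumes "\<And>i. closed (\<Omega> i)"
  shows "closed (joint_set own \<Omega>)"
proof -
  have "joint_set own \<Omega> = (\<Inter>i. block own i -` \<Omega> i)" by (auto simp: joint_set_def)
  moreover have "closed (block own i -` \<Omega> i)" for i
    using assms by (intro closed_vimage linear_continuous_on)
      (auto simp: linear_conv_bounded_linear[symmetric] linear_block)
  ultimately show ?thesis by auto
qed

lemma convex_joint_set:
  assumes "\<And>i. convex (\<Omega> i)"
  shows "convex (joint_set own \<Omega>)"
  using assms by (auto simp: joint_set_def convex_def linear_add[OF linear_block] linear_scale[OF linear_block])

text \<open>
  The differentiated function does not change when \<open>u\<close> is replaced by its block \<open>i\<close>. By the chain
  rule its derivative at \<open>y\<close> factors through the block map and so ignores the other players'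
  directions. This also shows that the gradient, defined by a description operator, exists.
\<close>
lemma partial_grad_in_strategy_space:
  assumes diff: "\<And>u. (\<lambda>u. g (deviate own i u y)) differentiable (at u)"
  shows "partial_grad own i g y \<in> strategy_space own i"
proof -
  let ?h = "\<lambda>u. g (deviate own i u y)"
  obtain D' where D': "(?h has_derivative D') (at (block own i y))"
    using diff by (auto simp: differentiable_def)
  have "((\<lambda>u. ?h (block own i u)) has_derivative (\<lambda>v. D' (block own i v))) (at y)"
    using has_derivative_compose[OF linear_imp_has_derivative[OF linear_block] D'] .
  moreover have "deviate own i (block own i u) y = deviate own i u y" for u
    by (simp add: deviate_def vec_eq_iff)
  ultimately have der: "(?h has_derivative (\<lambda>v. D' (block own i v))) (at y)" by simp
  then have lin: "linear (\<lambda>v. D' (block own i v))" by (rule has_derivative_linear)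
  define D where "D = adjoint (\<lambda>v. D' (block own i v)) 1"
  have D: "v \<bullet> D = D' (block own i v)" for v
    using adjoint_works[OF lin, of v 1] by (simp add: D_def)
  have "GDERIV ?h y :> D" using der by (simp add: gderiv_def D)
  moreover have "E = D" if "GDERIV ?h y :> E" for E
  proof -
    have "(\<lambda>v. v \<bullet> E) = (\<lambda>v. D' (block own i v))"
      using that der has_derivative_unique by (auto simp: gderiv_def)
    then have "(E - D) \<bullet> (E - D) = 0" using D by (simp add: inner_diff_right) (metis (no_types))
    then show ?thesis by simp
  qed
  ultimately have "partial_grad own i g y = D"
    unfolding partial_grad_def by (intro the_equality)
  moreover have "D $ j = 0" if "own j \<noteq> i" for j
  proof -
    have "block own i (axis j 1) = 0" using that by (auto simp: vec_eq_iff axis_def)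
    then have "axis j 1 \<bullet> D = 0" using D linear_0[OF has_derivative_linear[OF D']] by simp
    then show ?thesis by (simp add: inner_axis')
  qed
  ultimately show ?thesis by (simp add: strategy_space_def)
qed

lemma block_pseudo_grad:
  assumes "\<And>i u. (\<lambda>u. f i (deviate own i u y)) differentiable (at u)"
  shows "block own i (pseudo_grad own f y) = partial_grad own i (f i) y"
  using partial_grad_in_strategy_space[OF assms, of i]
  by (auto simp: vec_eq_iff pseudo_grad_def strategy_space_def)

text \<open>
  The map \<open>\<Lambda>\<close> of the introduction.
\<close>
definition local_products ::
    "('n::finite \<Rightarrow> 'p) \<Rightarrow> real ^ 'n ^ 'm \<Rightarrow> real ^ 'n \<Rightarrow> (real ^ 'm) ^ 'p::finite" where
  "local_products own A x = (\<chi> i. col_block own i A *v x)"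

definition local_products_adjoint ::
    "('n \<Rightarrow> 'p) \<Rightarrow> real ^ 'n ^ 'm \<Rightarrow> (real ^ 'm) ^ 'p::finite \<Rightarrow> real ^ 'n::finite" where
  "local_products_adjoint own A l = (\<chi> j. \<Sum>r\<in>UNIV. A $ r $ j * l $ own j $ r)"

lemma block_local_products_adjoint:
  "block own i (local_products_adjoint own A l) = transpose (col_block own i A) *v (l $ i)"
  by (simp add: vec_eq_iff local_products_adjoint_def matrix_vector_mult_def transpose_def col_block_def)

lemma linear_local_products: "linear (local_products own A)"
  by (intro linearI) (simp_all add: local_products_def vec_eq_iff matrix_vector_right_distrib
      matrix_vector_mult_scaleR)

lemma linear_local_products_adjoint: "linear (local_products_adjoint own A)"
  by (intro linearI) (simp_all add: local_products_adjoint_def vec_eq_iff sum.distrib sum_distrib_left algebra_simps)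

lemma local_products_adjoint:
  "local_products own A x \<bullet> l = x \<bullet> local_products_adjoint own A l"
proof -
  have "(col_block own i A *v x) \<bullet> l $ i = block own i x \<bullet> block own i (local_products_adjoint own A l)" for i
  proof -
    have "(col_block own i A *v x) \<bullet> l $ i = (transpose (col_block own i A) *v l $ i) \<bullet> x"
      using dot_lmul_matrix[of "l $ i" "col_block own i A" x] by (simp add: inner_commute)
    then show ?thesis
      using inner_block[of own i "local_products_adjoint own A l" x]
      by (simp only: block_local_products_adjoint inner_commute)
  qed
  then show ?thesis
    unfolding inner_eq_sum_blocks[of x _ own] by (subst inner_vec_def) (simp add: local_products_def)
qed

lemma sum_local_products: "(\<Sum>i\<in>UNIV. local_products own A x $ i) = A *v x"
  by (simp add: vec_eq_iff local_products_def matrix_vector_mult_def col_block_def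
      if_distrib[of "\<lambda>t. t * _"] sum.swap[of _ UNIV UNIV] cong: if_cong)

lemma local_products_adjoint_const:
  "local_products_adjoint own A (\<chi> i. l) = transpose A *v l"
  by (simp add: vec_eq_iff local_products_adjoint_def matrix_vector_mult_def transpose_def)

text \<open>
  The contribution of \<open>\<Lambda>\<close> to the diagonal dominance of the step metric: by
  \<open>2 s t \<le> s\<^sup>2 + t\<^sup>2\<close>, every entry of \<open>A\<close> is charged once to its column and once to its row.
\<close>
lemma local_products_cross_term_bound:
  fixes own :: "'n::finite \<Rightarrow> 'p::finite" and A :: "real ^ 'n ^ 'm::finite"
  assumes col: "\<And>j. (\<Sum>r\<in>UNIV. \<bar>A $ r $ j\<bar>) \<le> c j"
    and row: "\<And>i r. (\<Sum>j | own j = i. \<bar>A $ r $ j\<bar>) \<le> e i"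
  shows "- ((\<Sum>j\<in>UNIV. c j * (x $ j)\<^sup>2) + (\<Sum>i\<in>UNIV. e i * (norm (l $ i))\<^sup>2))
    \<le> 2 * (local_products own A x \<bullet> l)"
proof -
  have *: "- (\<bar>a\<bar> * s\<^sup>2 + \<bar>a\<bar> * t\<^sup>2) \<le> 2 * (s * (a * t))" for a s t :: real
  proof -
    have "\<bar>2 * (s * (a * t))\<bar> \<le> \<bar>a\<bar> * (s\<^sup>2 + t\<^sup>2)"
      using sum_squares_bound[of "\<bar>s\<bar>" "\<bar>t\<bar>"] mult_left_mono[of "2 * \<bar>s\<bar> * \<bar>t\<bar>" "s\<^sup>2 + t\<^sup>2" "\<bar>a\<bar>"]
      by (simp add: abs_mult mult_ac)
    then show ?thesis by (simp add: distrib_left)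
  qed
  have "(\<Sum>j\<in>UNIV. \<Sum>r\<in>UNIV. \<bar>A $ r $ j\<bar> * (l $ own j $ r)\<^sup>2)
      = (\<Sum>r\<in>UNIV. \<Sum>i\<in>UNIV. \<Sum>j | own j = i. \<bar>A $ r $ j\<bar> * (l $ own j $ r)\<^sup>2)"
    by (subst sum.swap) (simp only: sum.group[of UNIV UNIV own, simplified])
  also have "\<dots> = (\<Sum>r\<in>UNIV. \<Sum>i\<in>UNIV. (\<Sum>j | own j = i. \<bar>A $ r $ j\<bar>) * (l $ i $ r)\<^sup>2)"
    by (simp add: sum_distrib_right)
  also have "\<dots> \<le> (\<Sum>r\<in>UNIV. \<Sum>i\<in>UNIV. e i * (l $ i $ r)\<^sup>2)"
    by (intro sum_mono mult_right_mono row) simp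
  also have "\<dots> = (\<Sum>i\<in>UNIV. e i * (norm (l $ i))\<^sup>2)"
    unfolding power2_norm_eq_inner
    by (subst sum.swap) (simp add: inner_vec_def sum_distrib_left power2_eq_square)
  finally have rows: "(\<Sum>j\<in>UNIV. \<Sum>r\<in>UNIV. \<bar>A $ r $ j\<bar> * (l $ own j $ r)\<^sup>2)
    \<le> (\<Sum>i\<in>UNIV. e i * (norm (l $ i))\<^sup>2)" .
  have "(\<Sum>j\<in>UNIV. \<Sum>r\<in>UNIV. \<bar>A $ r $ j\<bar> * (x $ j)\<^sup>2) \<le> (\<Sum>j\<in>UNIV. c j * (x $ j)\<^sup>2)"
    unfolding sum_distrib_right[symmetric] by (intro sum_mono mult_right_mono col) simp
  with rows have "- ((\<Sum>j\<in>UNIV. c j * (x $ j)\<^sup>2) + (\<Sum>i\<in>UNIV. e i * (norm (l $ i))\<^sup>2))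
    \<le> (\<Sum>j\<in>UNIV. \<Sum>r\<in>UNIV. - (\<bar>A $ r $ j\<bar> * (x $ j)\<^sup>2 + \<bar>A $ r $ j\<bar> * (l $ own j $ r)\<^sup>2))"
    unfolding sum_negf sum.distrib by linarith
  also have "\<dots> \<le> (\<Sum>j\<in>UNIV. \<Sum>r\<in>UNIV. 2 * (x $ j * (A $ r $ j * l $ own j $ r)))"
    by (intro sum_mono *)
  also have "\<dots> = 2 * (local_products own A x \<bullet> l)"
    unfolding local_products_adjoint
    by (simp add: inner_vec_def local_products_adjoint_def sum_distrib_left)
  finally show ?thesis .
qed

section \<open>Multipliers and the variational equilibrium\<close>

text \<open>
  The KKT conditions of the variational inequality over \<open>{x \<in> C. A x \<ge> d}\<close>, with both normal cone
  inclusions written as variational inequalities.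
\<close>
definition multiplier_pair ::
    "(real ^ 'n::finite \<Rightarrow> real ^ 'n) \<Rightarrow> (real ^ 'n) set \<Rightarrow> real ^ 'n ^ 'm::finite \<Rightarrow> real ^ 'm
      \<Rightarrow> real ^ 'n \<Rightarrow> real ^ 'm \<Rightarrow> bool" where
  "multiplier_pair F C A d xs ls \<longleftrightarrow>
     VI_solution (\<lambda>x. F x - transpose A *v ls) C xs \<and>
     VI_solution (\<lambda>_. A *v xs - d) nonneg_orthant ls"

text \<open>
  The second inequality of \<open>multiplier_pair\<close> encodes feasibility and complementary slackness: test
  it with \<open>ls + axis r 1\<close>, with \<open>0\<close> and with \<open>2 *\<^sub>R ls\<close>.
\<close>
lemma complementary_iff_VI_nonneg_orthant:
  "VI_solution (\<lambda>_. s) nonneg_orthant ls \<longleftrightarrow>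
    ls \<in> nonneg_orthant \<and> s \<in> nonneg_orthant \<and> s \<bullet> ls = 0"
proof
  assume L: "VI_solution (\<lambda>_. s) nonneg_orthant ls"
  then have ls: "ls \<in> nonneg_orthant" and ge: "\<And>u. u \<in> nonneg_orthant \<Longrightarrow> 0 \<le> s \<bullet> (u - ls)"
    by (auto simp: VI_solution_def)
  have "0 \<le> s $ r" for r
    using ge[of "ls + axis r 1"] ls by (auto simp: nonneg_orthant_def axis_def inner_axis[unfolded axis_def])
  moreover have "s \<bullet> ls = 0"
    using ge[of 0] ge[of "2 *\<^sub>R ls"] ls by (simp add: nonneg_orthant_def inner_diff_right)
  ultimately show "ls \<in> nonneg_orthant \<and> s \<in> nonneg_orthant \<and> s \<bullet> ls = 0"
    using ls by (simp add: nonneg_orthant_def)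
next
  assume "ls \<in> nonneg_orthant \<and> s \<in> nonneg_orthant \<and> s \<bullet> ls = 0"
  then show "VI_solution (\<lambda>_. s) nonneg_orthant ls"
    by (auto simp: VI_solution_def inner_diff_right nonneg_orthant_def inner_vec_def[of s] intro!: sum_nonneg)
qed

lemma multiplier_pair_imp_variational_GNE:
  assumes "multiplier_pair (pseudo_grad own f) (joint_set own \<Omega>) A (\<Sum>i\<in>UNIV. b i) xs ls"
  shows "variational_GNE own f \<Omega> A b xs"
proof -
  let ?F = "pseudo_grad own f" and ?d = "\<Sum>i\<in>UNIV. b i"
  have xs: "xs \<in> joint_set own \<Omega>"
    and opt: "\<And>y. y \<in> joint_set own \<Omega> \<Longrightarrow> 0 \<le> (?F xs - transpose A *v ls) \<bullet> (y - xs)"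
    and ls: "ls \<in> nonneg_orthant" "A *v xs - ?d \<in> nonneg_orthant" "(A *v xs - ?d) \<bullet> ls = 0"
    using assms unfolding multiplier_pair_def complementary_iff_VI_nonneg_orthant
    by (auto simp: VI_solution_def)
  have "0 \<le> ?F xs \<bullet> (y - xs)" if y: "y \<in> feasible_set own \<Omega> A b" for y
  proof -
    have "0 \<le> (?F xs - transpose A *v ls) \<bullet> (y - xs)"
      using opt y by (simp add: feasible_set_def)
    also have "\<dots> = ?F xs \<bullet> (y - xs) - ls \<bullet> (A *v y - ?d)"
      using ls(3) inner_commute[of "A *v xs - ?d" ls]
      by (simp add: inner_diff_left inner_diff_right dot_lmul_matrix)
    also have "\<dots> \<le> ?F xs \<bullet> (y - xs)"
      using ls(1) y by (auto simp: feasible_set_def nonneg_orthant_def inner_vec_def intro!: sum_nonneg)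
    finally show ?thesis .
  qed
  moreover have "xs \<in> feasible_set own \<Omega> A b"
    using xs ls(2) by (simp add: feasible_set_def nonneg_orthant_def)
  ultimately show ?thesis by (simp add: variational_GNE_def VI_solution_def)
qed

text \<open>
  A solution of the variational inequality minimizes the linear function with the constant coefficient
  vector \<open>F xs\<close> over the feasible set, so linear duality applies.
\<close>
lemma variational_GNE_has_multiplier:
  assumes "convex (joint_set own \<Omega>)" "interior (feasible_set own \<Omega> A b) \<noteq> {}"
    and "variational_GNE own f \<Omega> A b xs"
  shows "\<exists>ls. multiplier_pair (pseudo_grad own f) (joint_set own \<Omega>) A (\<Sum>i\<in>UNIV. b i) xs ls"
proof -
  let ?F = "pseudo_grad own f" and ?d = "\<Sum>i\<in>UNIV. b i"
  have X: "feasible_set own \<Omega> A b = joint_set own \<Omega> \<inter> {x. \<forall>r. ?d $ r \<le> (A *v x) $ r}"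
    by (simp add: feasible_set_def)
  obtain x0 where x0: "x0 \<in> interior (feasible_set own \<Omega> A b)" using assms by blast
  have min: "VI_solution (\<lambda>_. ?F xs) (joint_set own \<Omega> \<inter> {x. \<forall>r. ?d $ r \<le> (A *v x) $ r}) xs"
    using assms(3) unfolding X[symmetric] by (simp add: variational_GNE_def VI_solution_def)
  obtain ls where ls: "ls \<in> nonneg_orthant" "ls \<bullet> (A *v xs - ?d) = 0"
    "VI_solution (\<lambda>_. ?F xs - transpose A *v ls) (joint_set own \<Omega>) xs"
    by (rule linear_program_multiplier[OF assms(1) x0[unfolded X] min])
  have "A *v xs - ?d \<in> nonneg_orthant"
    using assms(3) by (simp add: variational_GNE_def VI_solution_def feasible_set_def nonneg_orthant_def)
  with ls show ?thesis
    unfolding multiplier_pair_def complementary_iff_VI_nonneg_orthant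
    by (auto simp: VI_solution_def inner_commute)
qed

lemma deviate_in_joint_set:
  assumes "x \<in> joint_set own \<Omega>" "u \<in> \<Omega> i" "u \<in> strategy_space own i"
  shows "deviate own i u x \<in> joint_set own \<Omega>"
proof -
  have "block own k (deviate own i u x) = (if k = i then u else block own k x)" for k
    using assms(3) by (auto simp: vec_eq_iff deviate_def strategy_space_def)
  then show ?thesis using assms by (simp add: joint_set_def)
qed

text \<open>
  The joint inequality over \<open>\<Omega>\<close> splits into one for each player by testing it only with
  unilateral deviations.
\<close>
lemma multiplier_pair_imp_KKT:
  assumes strat: "\<And>i. \<Omega> i \<subseteq> strategy_space own i"
    and diff: "\<And>i y u. (\<lambda>u. f i (deviate own i u y)) differentiable (at u)"
    and pair: "multiplier_pair (pseudo_grad own f) (joint_set own \<Omega>) A (\<Sum>i\<in>UNIV. b i) xs ls"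
  shows "KKT own f \<Omega> A b xs ls"
proof -
  let ?F = "pseudo_grad own f" and ?d = "\<Sum>i\<in>UNIV. b i"
  have xs: "xs \<in> joint_set own \<Omega>"
    and opt: "\<And>y. y \<in> joint_set own \<Omega> \<Longrightarrow> 0 \<le> (?F xs - transpose A *v ls) \<bullet> (y - xs)"
    and cone: "ls \<in> nonneg_orthant" "\<And>u. u \<in> nonneg_orthant \<Longrightarrow> 0 \<le> (A *v xs - ?d) \<bullet> (u - ls)"
    using pair by (auto simp: VI_solution_def multiplier_pair_def)
  have "\<exists>v \<in> normal_cone (\<Omega> i) (block own i xs) \<inter> strategy_space own i.
        0 = partial_grad own i (f i) xs - transpose (col_block own i A) *v ls + v" for i
  proof -
    define v where "v = - block own i (?F xs - transpose A *v ls)"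
    have block_v: "partial_grad own i (f i) xs - transpose (col_block own i A) *v ls = - v"
      using block_local_products_adjoint[of own i A "\<chi> i. ls"]
      by (simp add: v_def local_products_adjoint_const linear_diff[OF linear_block]
          block_pseudo_grad[OF diff])
    have "v \<bullet> (u - block own i xs) \<le> 0" if u: "u \<in> \<Omega> i" for u
    proof -
      have us: "u \<in> strategy_space own i" using u strat by blast
      have "deviate own i u xs - xs = u - block own i xs"
        using us by (auto simp: vec_eq_iff deviate_def strategy_space_def)
      then have "0 \<le> (?F xs - transpose A *v ls) \<bullet> (u - block own i xs)"
        using opt[OF deviate_in_joint_set[OF xs u us]] by simp
      also have "u - block own i xs = block own i (u - block own i xs)"
        using us by (auto simp: vec_eq_iff strategy_space_def)
      finally have "0 \<le> block own i (u - block own i xs) \<bullet> block own i (?F xs - transpose A *v ls)"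
        by (metis inner_block inner_commute)
      also have "block own i (u - block own i xs) = u - block own i xs"
        using us by (auto simp: vec_eq_iff strategy_space_def)
      finally show ?thesis by (simp add: v_def inner_commute)
    qed
    then have "v \<in> normal_cone (\<Omega> i) (block own i xs)"
      using xs by (simp add: normal_cone_def joint_set_def)
    moreover have "v \<in> strategy_space own i" by (simp add: v_def strategy_space_def)
    ultimately show ?thesis using block_v by (intro bexI[of _ v]) auto
  qed
  moreover have "- (A *v xs - ?d) \<in> normal_cone nonneg_orthant ls"
    unfolding normal_cone_def using cone by (auto simp: inner_minus_left simp del: minus_diff_eq)
  ultimately show ?thesis
    unfolding KKT_def by (auto intro!: bexI[of _ "- (A *v xs - ?d)"])
qed

section \<open>The variational inequality with local multipliers\<close>

type_synonym ('n, 'm, 'p) primal_dual = "(real ^ 'n) \<times> ((real ^ 'm) ^ 'p) \<times> ((real ^ 'm) ^ 'p)"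

text \<open>
  A triple \<open>(x, z, l)\<close> collects the decisions, the consensus variables and the local multipliers. This
  definition and the three after it are \<open>K\<close>, \<open>G\<close>, \<open>S\<close> and \<open>P\<close> of the introduction.
\<close>
definition primal_dual_domain ::
    "('n::finite \<Rightarrow> 'p::finite) \<Rightarrow> ('p \<Rightarrow> (real ^ 'n) set) \<Rightarrow> ('n, 'm::finite, 'p) primal_dual set" where
  "primal_dual_domain own \<Omega> = joint_set own \<Omega> \<times> UNIV \<times> {l. \<forall>i. l $ i \<in> nonneg_orthant}"

definition forward_part ::
    "('n::finite \<Rightarrow> 'p::finite) \<Rightarrow> ('p \<Rightarrow> real ^ 'n \<Rightarrow> real) \<Rightarrow> ('p \<Rightarrow> real ^ 'm::finite) \<Rightarrow> real ^ 'p ^ 'p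
      \<Rightarrow> ('n, 'm, 'p) primal_dual \<Rightarrow> ('n, 'm, 'p) primal_dual" where
  "forward_part own f b W = (\<lambda>(x, z, l). (pseudo_grad own f x, 0, laplacian W l - (\<chi> i. b i)))"

definition skew_part ::
    "('n::finite \<Rightarrow> 'p::finite) \<Rightarrow> real ^ 'n ^ 'm::finite \<Rightarrow> real ^ 'p ^ 'p
      \<Rightarrow> ('n, 'm, 'p) primal_dual \<Rightarrow> ('n, 'm, 'p) primal_dual" where
  "skew_part own A W = (\<lambda>(x, z, l).
     (- local_products_adjoint own A l, - laplacian W l, local_products own A x + laplacian W z))"

definition step_metric ::
    "('n::finite \<Rightarrow> 'p::finite) \<Rightarrow> real ^ 'n ^ 'm::finite \<Rightarrow> real ^ 'p ^ 'p
      \<Rightarrow> ('p \<Rightarrow> real) \<Rightarrow> ('p \<Rightarrow> real) \<Rightarrow> ('p \<Rightarrow> real)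
      \<Rightarrow> ('n, 'm, 'p) primal_dual \<Rightarrow> ('n, 'm, 'p) primal_dual" where
  "step_metric own A W \<tau> \<nu> \<sigma> = (\<lambda>(x, z, l).
     ((\<chi> j. x $ j / \<tau> (own j)) + local_products_adjoint own A l,
      (\<chi> i. z $ i /\<^sub>R \<nu> i) + laplacian W l,
      local_products own A x + laplacian W z + (\<chi> i. l $ i /\<^sub>R \<sigma> i)))"

lemma linear_skew_part: "linear (skew_part own A W)"
  by (intro linearI) (auto simp: skew_part_def linear_add[OF linear_laplacian]
      linear_add[OF linear_local_products] linear_add[OF linear_local_products_adjoint]
      linear_scale[OF linear_laplacian] linear_scale[OF linear_local_products]
      linear_scale[OF linear_local_products_adjoint] scaleR_add_right)

lemma skew_part_skew:
  assumes "\<And>i j. W $ i $ j = W $ j $ i"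
  shows "skew_part own A W w \<bullet> w = 0"
proof -
  obtain x z l where w: "w = (x, z, l)" by (metis prod.exhaust)
  show ?thesis
    using inner_commute[of x "local_products_adjoint own A l"] inner_commute[of z "laplacian W l"]
    by (simp add: w skew_part_def inner_add_left local_products_adjoint laplacian_self_adjoint[OF assms, of z l])
qed

lemma linear_step_metric: "linear (step_metric own A W \<tau> \<nu> \<sigma>)"
  by (intro linearI) (auto simp: step_metric_def linear_add[OF linear_laplacian]
      linear_add[OF linear_local_products] linear_add[OF linear_local_products_adjoint]
      linear_scale[OF linear_laplacian] linear_scale[OF linear_local_products]
      linear_scale[OF linear_local_products_adjoint] scaleR_add_right vec_eq_iff add_divide_distrib)

lemma step_metric_self_adjoint:
  assumes "\<And>i j. W $ i $ j = W $ j $ i"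
  shows "step_metric own A W \<tau> \<nu> \<sigma> u \<bullet> v = u \<bullet> step_metric own A W \<tau> \<nu> \<sigma> v"
proof -
  obtain x z l x' z' l' where uv: "u = (x, z, l)" "v = (x', z', l')" by (metis prod.exhaust)
  have "(\<chi> j. x $ j / \<tau> (own j)) \<bullet> x' = x \<bullet> (\<chi> j. x' $ j / \<tau> (own j))"
    "(\<chi> i. z $ i /\<^sub>R \<nu> i) \<bullet> z' = z \<bullet> (\<chi> i. z' $ i /\<^sub>R \<nu> i)"
    "(\<chi> i. l $ i /\<^sub>R \<sigma> i) \<bullet> l' = l \<bullet> (\<chi> i. l' $ i /\<^sub>R \<sigma> i)"
    by (simp_all add: inner_vec_def[of _ x'] inner_vec_def[of x] inner_vec_def[of _ z'] inner_vec_def[of z]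
        inner_vec_def[of _ l'] inner_vec_def[of l])
  moreover have "local_products_adjoint own A l \<bullet> x' = l \<bullet> local_products own A x'"
    by (metis inner_commute local_products_adjoint)
  ultimately show ?thesis
    by (simp add: uv step_metric_def inner_add_left inner_add_right local_products_adjoint
        laplacian_self_adjoint[OF assms])
qed

text \<open>
  Diagonal dominance: \<open>\<delta>\<close> is the margin that the inverse step sizes leave after the cross terms of
  \<open>\<Lambda>\<close> and \<open>L\<close> are absorbed.
\<close>
lemma step_metric_bounded_below:
  assumes sym: "\<And>i j. W $ i $ j = W $ j $ i" and nonneg: "\<And>i j. W $ i $ j \<ge> 0"
    and tau: "\<And>j. \<delta> + (\<Sum>r\<in>UNIV. \<bar>A $ r $ j\<bar>) \<le> 1 / \<tau> (own j)"
    and nu: "\<And>i. \<delta> + 2 * degree W i \<le> 1 / \<nu> i"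
    and sigma: "\<And>i r. \<delta> + 2 * degree W i + (\<Sum>j | own j = i. \<bar>A $ r $ j\<bar>) \<le> 1 / \<sigma> i"
  shows "\<delta> * (norm w)\<^sup>2 \<le> step_metric own A W \<tau> \<nu> \<sigma> w \<bullet> w"
proof -
  obtain x z l where w: "w = (x, z, l)" by (metis prod.exhaust)
  have c1: "- ((\<Sum>j\<in>UNIV. (1 / \<tau> (own j) - \<delta>) * (x $ j)\<^sup>2)
      + (\<Sum>i\<in>UNIV. (1 / \<sigma> i - \<delta> - 2 * degree W i) * (norm (l $ i))\<^sup>2)) \<le> 2 * (local_products own A x \<bullet> l)"
    by (rule local_products_cross_term_bound) (use tau sigma in \<open>force simp: algebra_simps\<close>)+
  have c2: "- (\<Sum>i\<in>UNIV. 2 * degree W i * ((norm (z $ i))\<^sup>2 + (norm (l $ i))\<^sup>2)) \<le> 2 * (laplacian W z \<bullet> l)"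
    by (rule laplacian_cross_term_bound[OF sym nonneg])
  have c3: "(\<Sum>i\<in>UNIV. (\<delta> + 2 * degree W i) * (norm (z $ i))\<^sup>2) \<le> (\<Sum>i\<in>UNIV. 1 / \<nu> i * (norm (z $ i))\<^sup>2)"
    by (intro sum_mono mult_right_mono nu) simp
  have norms: "(norm w)\<^sup>2 = (\<Sum>j\<in>UNIV. (x $ j)\<^sup>2) + (\<Sum>i\<in>UNIV. (norm (z $ i))\<^sup>2) + (\<Sum>i\<in>UNIV. (norm (l $ i))\<^sup>2)"
    by (simp add: w power2_norm_eq_inner inner_vec_def power2_eq_square[of "x $ _"])
  have "step_metric own A W \<tau> \<nu> \<sigma> w \<bullet> w = (\<Sum>j\<in>UNIV. 1 / \<tau> (own j) * (x $ j)\<^sup>2)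
      + (\<Sum>i\<in>UNIV. 1 / \<nu> i * (norm (z $ i))\<^sup>2) + (\<Sum>i\<in>UNIV. 1 / \<sigma> i * (norm (l $ i))\<^sup>2)
      + 2 * (local_products own A x \<bullet> l) + 2 * (laplacian W z \<bullet> l)"
  proof -
    have "(\<chi> j. x $ j / \<tau> (own j)) \<bullet> x = (\<Sum>j\<in>UNIV. 1 / \<tau> (own j) * (x $ j)\<^sup>2)"
      "(\<chi> i. z $ i /\<^sub>R \<nu> i) \<bullet> z = (\<Sum>i\<in>UNIV. 1 / \<nu> i * (norm (z $ i))\<^sup>2)"
      "(\<chi> i. l $ i /\<^sub>R \<sigma> i) \<bullet> l = (\<Sum>i\<in>UNIV. 1 / \<sigma> i * (norm (l $ i))\<^sup>2)"
      by (simp_all add: inner_vec_def[of "\<chi> j. _ j"] power2_norm_eq_inner power2_eq_square[of "x $ _"] inverse_eq_divide)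
    moreover have "local_products_adjoint own A l \<bullet> x = local_products own A x \<bullet> l"
      by (metis inner_commute local_products_adjoint)
    moreover have "laplacian W l \<bullet> z = laplacian W z \<bullet> l"
      by (metis inner_commute laplacian_self_adjoint[OF sym])
    ultimately show ?thesis
      by (simp add: w step_metric_def inner_add_left)
  qed
  with c1 c2 c3 show ?thesis
    unfolding norms by (simp add: algebra_simps sum.distrib sum_subtractf sum_distrib_left)
qed

text \<open>
  A map that is strongly monotone with constant \<open>\<eta>\<close> and Lipschitz with constant \<open>\<theta>\<close> is
  cocoercive with constant \<open>\<eta> / \<theta>\<^sup>2\<close>, and the Laplacian is cocoercive with the inverse of twice
  the maximal degree. Bounding the degrees by \<open>1 / (2 \<beta>)\<close>, rather than \<open>\<beta>\<close> by
  their inverse, also covers the graph without edges.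
\<close>
lemma forward_part_cocoercive:
  fixes own :: "'n::finite \<Rightarrow> 'p::finite" and b :: "'p \<Rightarrow> real ^ 'm::finite"
  assumes sym: "\<And>i j. W $ i $ j = W $ j $ i" and nonneg: "\<And>i j. W $ i $ j \<ge> 0"
    and "\<eta> > 0" "\<theta> > 0"
    and mono: "\<And>u v. \<lbrakk>u \<in> joint_set own \<Omega>; v \<in> joint_set own \<Omega>\<rbrakk> \<Longrightarrow>
          (pseudo_grad own f u - pseudo_grad own f v) \<bullet> (u - v) \<ge> \<eta> * (norm (u - v))\<^sup>2"
    and lip: "\<And>u v. \<lbrakk>u \<in> joint_set own \<Omega>; v \<in> joint_set own \<Omega>\<rbrakk> \<Longrightarrow>
          norm (pseudo_grad own f u - pseudo_grad own f v) \<le> \<theta> * norm (u - v)"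
    and "0 < \<beta>" and deg: "\<And>i. degree W i \<le> 1 / (2 * \<beta>)" and game: "\<beta> \<le> \<eta> / \<theta>\<^sup>2"
    and uv: "u \<in> primal_dual_domain own \<Omega>" "v \<in> primal_dual_domain own \<Omega>"
  shows "\<beta> * (norm (forward_part own f b W u - forward_part own f b W v))\<^sup>2
    \<le> (forward_part own f b W u - forward_part own f b W v) \<bullet> (u - v)"
proof -
  obtain x z l x' z' l' where eq: "u = (x, z, l)" "v = (x', z', l')" by (metis prod.exhaust)
  have xx: "x \<in> joint_set own \<Omega>" "x' \<in> joint_set own \<Omega>" using uv by (auto simp: eq primal_dual_domain_def)
  let ?g = "pseudo_grad own f x - pseudo_grad own f x'" and ?k = "laplacian W (l - l')"
  have "\<beta> * (norm ?g)\<^sup>2 \<le> \<eta> / \<theta>\<^sup>2 * (\<theta> * norm (x - x'))\<^sup>2"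
    using game \<open>0 < \<beta>\<close> \<open>0 < \<eta>\<close> lip[OF xx] by (intro mult_mono power_mono) auto
  also have "\<dots> = \<eta> * (norm (x - x'))\<^sup>2" using \<open>\<theta> > 0\<close> by (simp add: power_mult_distrib)
  also have "\<dots> \<le> ?g \<bullet> (x - x')" by (rule mono[OF xx])
  finally have g: "\<beta> * (norm ?g)\<^sup>2 \<le> ?g \<bullet> (x - x')" .
  have k: "\<beta> * (norm ?k)\<^sup>2 \<le> ?k \<bullet> (l - l')"
    using laplacian_cocoercive[OF sym nonneg deg, of "l - l'"] \<open>0 < \<beta>\<close> by (simp add: field_simps)
  have "forward_part own f b W u - forward_part own f b W v = (?g, 0, ?k)"
    by (simp add: eq forward_part_def linear_diff[OF linear_laplacian])
  then show ?thesis
    using g k by (simp add: eq power2_norm_eq_inner distrib_left)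
qed

text \<open>
  The component \<open>z\<close> is unconstrained, so \<open>L l = 0\<close> and all copies of the multiplier agree. Testing
  with equal copies \<open>m\<^sub>i = u\<close> adds up the players' rows, and \<open>L zs\<close> drops out since its components
  sum to zero.
\<close>
lemma primal_dual_VI_imp_multiplier_pair:
  assumes sym: "\<And>i j. W $ i $ j = W $ j $ i" and nonneg: "\<And>i j. W $ i $ j \<ge> 0"
    and adj: "\<And>i j. j \<in> Nb i \<Longrightarrow> W $ i $ j > 0" and conn: "connected_graph Nb"
    and sol: "VI_solution (\<lambda>w. forward_part own f b W w + skew_part own A W w)
      (primal_dual_domain own \<Omega>) (xs, zs, l)"
  shows "\<exists>ls. l = (\<chi> i. ls) \<and>
    multiplier_pair (pseudo_grad own f) (joint_set own \<Omega>) A (\<Sum>i\<in>UNIV. b i) xs ls"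
proof -
  have xs: "xs \<in> joint_set own \<Omega>" and l: "\<And>i. l $ i \<in> nonneg_orthant"
    using sol by (auto simp: VI_solution_def primal_dual_domain_def)
  have VI: "0 \<le> (pseudo_grad own f xs - local_products_adjoint own A l) \<bullet> (y - xs)
      - laplacian W l \<bullet> (z - zs)
      + (laplacian W l - (\<chi> i. b i) + (local_products own A xs + laplacian W zs)) \<bullet> (m - l)"
    if "y \<in> joint_set own \<Omega>" "\<And>i. m $ i \<in> nonneg_orthant" for y z m
  proof -
    have "(y, z, m) \<in> primal_dual_domain own \<Omega>" using that by (simp add: primal_dual_domain_def)
    then have "0 \<le> (forward_part own f b W (xs, zs, l) + skew_part own A W (xs, zs, l)) \<bullet> ((y, z, m) - (xs, zs, l))"
      using sol unfolding VI_solution_def by blast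
    then show ?thesis by (simp add: forward_part_def skew_part_def)
  qed
  have "0 \<le> - (laplacian W l \<bullet> laplacian W l)"
    using VI[OF xs l, of "zs + laplacian W l"] by simp
  then have L0: "laplacian W l = 0" using inner_ge_zero[of "laplacian W l"] by simp
  fix k
  define ls where "ls = l $ k"
  have ls: "l = (\<chi> i. ls)"
    using laplacian_kernel[OF sym nonneg adj conn L0, of _ k] by (simp add: vec_eq_iff ls_def)
  have "0 \<le> (pseudo_grad own f xs - transpose A *v ls) \<bullet> (y - xs)" if "y \<in> joint_set own \<Omega>" for y
    using VI[OF that l, of zs] by (simp add: ls local_products_adjoint_const)
  moreover have "0 \<le> (A *v xs - (\<Sum>i\<in>UNIV. b i)) \<bullet> (u - ls)" if "u \<in> nonneg_orthant" for u
  proof -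
    let ?v = "local_products own A xs + laplacian W zs - (\<chi> i. b i)"
    have "0 \<le> ?v \<bullet> ((\<chi> i. u) - l)"
      using VI[OF xs, of "\<chi> i. u" zs] that L0 by (simp add: algebra_simps)
    also have "\<dots> = (\<Sum>i\<in>UNIV. ?v $ i) \<bullet> (u - ls)"
      unfolding ls inner_sum_left by (subst inner_vec_def) simp
    also have "(\<Sum>i\<in>UNIV. ?v $ i) = A *v xs - (\<Sum>i\<in>UNIV. b i)"
      by (simp add: sum.distrib sum_subtractf sum_local_products sum_laplacian[OF sym])
    finally show ?thesis .
  qed
  ultimately have "multiplier_pair (pseudo_grad own f) (joint_set own \<Omega>) A (\<Sum>i\<in>UNIV. b i) xs ls"
    using xs l by (simp add: multiplier_pair_def VI_solution_def ls_def)
  with ls show ?thesis by blast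
qed

text \<open>
  The joint slack \<open>A xs - \<Sum> b\<close> is shared equally among the players. The difference between a
  player's own slack \<open>A\<^sub>i xs\<^sub>i - b\<^sub>i\<close> and this share sums to zero over the players, so it is
  of the form \<open>- L zs\<close>.
\<close>
lemma multiplier_pair_imp_primal_dual_VI:
  fixes own :: "'n::finite \<Rightarrow> 'p::finite" and b :: "'p \<Rightarrow> real ^ 'm::finite"
  assumes sym: "\<And>i j. W $ i $ j = W $ j $ i" and nonneg: "\<And>i j. W $ i $ j \<ge> 0"
    and adj: "\<And>i j. j \<in> Nb i \<Longrightarrow> W $ i $ j > 0" and conn: "connected_graph Nb"
    and pair: "multiplier_pair (pseudo_grad own f) (joint_set own \<Omega>) A (\<Sum>i\<in>UNIV. b i) xs ls"
  shows "\<exists>zs. VI_solution (\<lambda>w. forward_part own f b W w + skew_part own A W w)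
      (primal_dual_domain own \<Omega>) (xs, zs, \<chi> i. ls)"
proof -
  let ?d = "\<Sum>i\<in>UNIV. b i"
  define s where "s = (A *v xs - ?d) /\<^sub>R real CARD('p)"
  define v where "v = (\<chi> i. s + b i) - local_products own A xs"
  have "(\<Sum>i\<in>(UNIV :: 'p set). s) = A *v xs - ?d" by (simp add: s_def sum_constant_scaleR del: sum_constant)
  then have "(\<Sum>i\<in>UNIV. v $ i) = 0"
    by (simp add: v_def sum.distrib sum_subtractf sum_local_products del: sum_constant)
  then obtain zs where zs: "laplacian W zs = v"
    using laplacian_range[OF sym nonneg adj conn] by blast
  have L0: "laplacian W (\<chi> i. ls) = 0" by (simp add: laplacian_def vec_eq_iff)
  have xs: "xs \<in> joint_set own \<Omega>" "ls \<in> nonneg_orthant"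
    and opt: "\<And>y. y \<in> joint_set own \<Omega> \<Longrightarrow> 0 \<le> (pseudo_grad own f xs - transpose A *v ls) \<bullet> (y - xs)"
    and cone: "\<And>u. u \<in> nonneg_orthant \<Longrightarrow> 0 \<le> (A *v xs - ?d) \<bullet> (u - ls)"
    using pair by (auto simp: VI_solution_def multiplier_pair_def)
  have at: "forward_part own f b W (xs, zs, \<chi> i. ls) + skew_part own A W (xs, zs, \<chi> i. ls)
      = (pseudo_grad own f xs - transpose A *v ls, 0, \<chi> i. s)"
    by (simp add: forward_part_def skew_part_def L0 local_products_adjoint_const zs)
      (simp add: v_def vec_eq_iff)
  have "0 \<le> (\<chi> i. s) \<bullet> (m - (\<chi> i. ls))" if "\<forall>i. m $ i \<in> nonneg_orthant" for m :: "(real ^ 'm) ^ 'p"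
    unfolding inner_vec_def[of "\<chi> i. s"] using that cone
    by (intro sum_nonneg) (simp add: s_def)
  then have "0 \<le> (forward_part own f b W (xs, zs, \<chi> i. ls) + skew_part own A W (xs, zs, \<chi> i. ls)) \<bullet> (w - (xs, zs, \<chi> i. ls))"
    if "w \<in> primal_dual_domain own \<Omega>" for w
    unfolding at using that opt by (cases w) (simp add: primal_dual_domain_def)
  then show ?thesis
    using xs by (intro exI[of _ zs]) (simp add: VI_solution_def primal_dual_domain_def)
qed

section \<open>One round of the algorithm is one step of the splitting\<close>

text \<open>
  The variational characterization of the projection, divided by the step size so that the step size
  appears only in the metric.
\<close>
lemma projected_step_VI:
  fixes p :: "'a::euclidean_space"
  assumes "convex C" "closed C" "t > 0" "y \<in> C" and q: "q = closest_point C (p - t *\<^sub>R g)"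
  shows "((p - q) /\<^sub>R t - g) \<bullet> (y - q) \<le> 0"
proof -
  have "(p - t *\<^sub>R g - q) \<bullet> (y - q) \<le> 0"
    unfolding q by (rule closest_point_dot) fact+
  moreover have "(p - q) /\<^sub>R t - g = (p - t *\<^sub>R g - q) /\<^sub>R t"
    using \<open>t > 0\<close> by (simp add: scaleR_diff_right)
  ultimately show ?thesis
    using \<open>t > 0\<close> by (simp add: mult_le_0_iff)
qed

lemma closed_nonneg_orthant: "closed (nonneg_orthant :: (real ^ 'm::finite) set)"
  and convex_nonneg_orthant: "convex (nonneg_orthant :: (real ^ 'm::finite) set)"
proof -
  have orthant: "nonneg_orthant = (\<Inter>r. {l :: real ^ 'm. 0 \<le> l $ r})"
    by (auto simp: nonneg_orthant_def)
  show "closed (nonneg_orthant :: (real ^ 'm) set)"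
    unfolding orthant by (intro closed_INT ballI closed_Collect_le continuous_intros)
  show "convex (nonneg_orthant :: (real ^ 'm) set)"
    by (auto simp: nonneg_orthant_def convex_def)
qed

lemma neighbour_sum_eq_laplacian:
  assumes "weighted_graph Nb W"
  shows "(\<Sum>j\<in>Nb i. W $ i $ j *\<^sub>R (u i - u j)) = laplacian W (\<chi> i. u i) $ i"
proof -
  have "W $ i $ j = 0" if "j \<notin> Nb i" for j
    using assms that unfolding weighted_graph_def by metis
  then show ?thesis
    by (simp add: laplacian_def) (rule sum.mono_neutral_left, auto)
qed

text \<open>
  After cancellation the row of \<open>x\<close> involves only the old multipliers and the row of \<open>l\<close> only
  extrapolated points and old multipliers; these two rows sum up the players' projection inequalities. The row of \<open>z\<close>
  is an equation because \<open>z\<close> is unconstrained.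
\<close>
lemma iteration_primal_dual_step:
  fixes own :: "'n::finite \<Rightarrow> 'p::finite" and A :: "real ^ 'n ^ 'm::finite"
  assumes graph: "weighted_graph Nb W"
    and diff: "\<And>i y u. (\<lambda>u. f i (deviate own i u y)) differentiable (at u)"
    and sets: "\<And>i. closed (\<Omega> i)" "\<And>i. convex (\<Omega> i)"
    and pos: "\<And>i. \<tau> i > 0" "\<And>i. \<nu> i > 0" "\<And>i. \<sigma> i > 0"
    and iter: "iteration own f \<Omega> A b Nb W \<tau> \<nu> \<sigma> x z l"
    and w: "\<And>k. w k = (x k, (\<chi> i. z k i), (\<chi> i. l k i))"
    and y: "y \<in> primal_dual_domain own \<Omega>"
  shows "(step_metric own A W \<tau> \<nu> \<sigma> (w k - w (Suc k)) - forward_part own f b W (w k)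
    - skew_part own A W (w (Suc k))) \<bullet> (y - w (Suc k)) \<le> 0"
proof -
  let ?X = "x (Suc k)" and ?Z = "\<chi> i. z (Suc k) i" and ?L = "\<chi> i. l (Suc k) i"
  let ?x = "x k" and ?z = "\<chi> i. z k i" and ?l = "\<chi> i. l k i"
  have y_in: "\<And>i. block own i (fst y) \<in> \<Omega> i" "\<And>i. snd (snd y) $ i \<in> nonneg_orthant"
    using y by (auto simp: primal_dual_domain_def joint_set_def)
  have x_step: "block own i ?X = closest_point (\<Omega> i) (block own i ?x
      - \<tau> i *\<^sub>R block own i (pseudo_grad own f ?x - local_products_adjoint own A ?l))" for i
    using iter block_local_products_adjoint[of own i A ?l]
    by (simp add: iteration_def linear_diff[OF linear_block] block_pseudo_grad[OF diff])
  have z_step: "z (Suc k) i = z k i + \<nu> i *\<^sub>R laplacian W ?l $ i" for i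
    using iter by (simp add: iteration_def neighbour_sum_eq_laplacian[OF graph])
  define g where "g = 2 *\<^sub>R local_products own A ?X - local_products own A ?x - (\<chi> i. b i)
      + laplacian W ?l + 2 *\<^sub>R laplacian W ?Z - laplacian W ?z"
  have l_step: "l (Suc k) i = closest_point nonneg_orthant (l k i - \<sigma> i *\<^sub>R g $ i)" for i
    using iter by (simp add: iteration_def neighbour_sum_eq_laplacian[OF graph] g_def local_products_def)
  define G where "G = pseudo_grad own f ?x - local_products_adjoint own A ?l"
  define p where "p = (\<chi> j. (?x - ?X) $ j / \<tau> (own j)) - G"
  define q where "q = (\<chi> i. (l k i - l (Suc k) i) /\<^sub>R \<sigma> i) - g"
  have "p \<bullet> (fst y - ?X) \<le> 0"
  proof -
    have "block own i p = (block own i ?x - block own i ?X) /\<^sub>R \<tau> i - block own i G" for i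
      by (auto simp: p_def vec_eq_iff divide_inverse mult.commute)
    then have "block own i p \<bullet> block own i (fst y - ?X) \<le> 0" for i
      using projected_step_VI[OF sets(2) sets(1) pos(1) y_in(1) x_step[folded G_def], of i]
      by (simp add: linear_diff[OF linear_block])
    then show ?thesis by (subst inner_eq_sum_blocks[of _ _ own]) (intro sum_nonpos)
  qed
  moreover have "q \<bullet> (snd (snd y) - ?L) \<le> 0"
    unfolding inner_vec_def[of q]
  proof (rule sum_nonpos)
    fix i
    show "q $ i \<bullet> (snd (snd y) - ?L) $ i \<le> 0"
      using projected_step_VI[OF convex_nonneg_orthant closed_nonneg_orthant pos(3) y_in(2) l_step, of i]
      by (simp add: q_def)
  qed
  moreover have "step_metric own A W \<tau> \<nu> \<sigma> (w k - w (Suc k)) - forward_part own f b W (w k)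
      - skew_part own A W (w (Suc k)) = (p, 0, q)"
  proof -
    have "(\<chi> i. (?z - ?Z) $ i /\<^sub>R \<nu> i) + laplacian W ?l = 0"
      using pos(2) by (simp add: vec_eq_iff z_step less_imp_neq[symmetric])
    then show ?thesis
      by (simp add: w step_metric_def forward_part_def skew_part_def p_def q_def G_def g_def
          linear_diff[OF linear_laplacian] linear_diff[OF linear_local_products]
          linear_diff[OF linear_local_products_adjoint] scaleR_2 algebra_simps)
  qed
  ultimately show ?thesis by (cases y) (simp add: w)
qed

lemma iteration_in_primal_dual_domain:
  fixes own :: "'n::finite \<Rightarrow> 'p::finite" and A :: "real ^ 'n ^ 'm::finite"
  assumes "\<And>i. closed (\<Omega> i)" "joint_set own \<Omega> \<noteq> {}"
    and "iteration own f \<Omega> A b Nb W \<tau> \<nu> \<sigma> x z l"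
  shows "(x (Suc k), (\<chi> i. z (Suc k) i), (\<chi> i. l (Suc k) i)) \<in> primal_dual_domain own \<Omega>"
proof -
  have "\<Omega> i \<noteq> {}" for i using assms(2) by (auto simp: joint_set_def)
  moreover have "(nonneg_orthant :: (real ^ 'm) set) \<noteq> {}"
    by (auto simp: nonneg_orthant_def intro!: exI[of _ 0])
  moreover have "\<exists>p. block own i (x (Suc k)) = closest_point (\<Omega> i) p"
    "\<exists>p. l (Suc k) i = closest_point nonneg_orthant p" for i
    using assms(3) unfolding iteration_def by blast+
  ultimately have "block own i (x (Suc k)) \<in> \<Omega> i" "l (Suc k) i \<in> nonneg_orthant" for i
    using closest_point_in_set assms(1) closed_nonneg_orthant by metis+
  then show ?thesis by (simp add: primal_dual_domain_def joint_set_def)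
qed

section \<open>Convergence of the distributed algorithm\<close>

theorem theorem5p7:
  fixes own :: "'n::finite \<Rightarrow> 'p::finite"
    and f :: "'p \<Rightarrow> real ^ 'n \<Rightarrow> real"
    and \<Omega> :: "'p \<Rightarrow> (real ^ 'n) set"
    and A :: "real ^ 'n ^ 'm::finite"
    and b :: "'p \<Rightarrow> real ^ 'm"
    and Nb :: "'p \<Rightarrow> 'p set"
    and W :: "real ^ 'p ^ 'p"
    and \<eta> \<theta> \<beta> \<delta> :: real
    and \<tau> \<nu> \<sigma> :: "'p \<Rightarrow> real"
    and x :: "nat \<Rightarrow> real ^ 'n"
    and z l :: "nat \<Rightarrow> 'p \<Rightarrow> real ^ 'm"
  assumes dims_pos: "surj own"
    and private_sets: "\<And>i. \<Omega> i \<subseteq> strategy_space own i"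
    and graph: "weighted_graph Nb W"
    and A1_diff: "\<And>i y u. (\<lambda>u. f i (deviate own i u y)) differentiable (at u)"
    and A1_convex: "\<And>i y. convex_on UNIV (\<lambda>u. f i (deviate own i u y))"
    and A1_sets: "\<And>i. closed (\<Omega> i)" "\<And>i. convex (\<Omega> i)"
    and A1_interior: "interior (feasible_set own \<Omega> A b) \<noteq> {}"
    and A2_pos: "\<eta> > 0" "\<theta> > 0"
    and A2_monotone: "\<And>u v. \<lbrakk>u \<in> joint_set own \<Omega>; v \<in> joint_set own \<Omega>\<rbrakk> \<Longrightarrow>
          (pseudo_grad own f u - pseudo_grad own f v) \<bullet> (u - v) \<ge> \<eta> * (norm (u - v))\<^sup>2"
    and A2_lipschitz: "\<And>u v. \<lbrakk>u \<in> joint_set own \<Omega>; v \<in> joint_set own \<Omega>\<rbrakk> \<Longrightarrow>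
          norm (pseudo_grad own f u - pseudo_grad own f v) \<le> \<theta> * norm (u - v)"
    and A3: "undirected_graph Nb" "connected_graph Nb" "W = transpose W"
    and beta_pos: "0 < \<beta>"
    and beta_degree: "max_degree W \<noteq> 0 \<Longrightarrow> \<beta> \<le> 1 / (2 * max_degree W)"
    and beta_game: "\<beta> \<le> \<eta> / \<theta>\<^sup>2"
    and delta: "\<delta> > 1 / (2 * \<beta>)"
    and steps_pos: "\<And>i. \<tau> i > 0" "\<And>i. \<nu> i > 0" "\<And>i. \<sigma> i > 0"
    and tau: "\<And>i. \<tau> i \<le> 1 / ((MAX j\<in>{j. own j = i}.
          \<Sum>k\<in>UNIV. \<bar>transpose (col_block own i A) $ j $ k\<bar>) + \<delta>)"
    and nu: "\<And>i. \<nu> i \<le> 1 / (2 * degree W i + \<delta>)"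
    and sigma: "\<And>i. \<sigma> i \<le> 1 / ((MAX j\<in>UNIV.
          \<Sum>k\<in>{k. own k = i}. \<bar>col_block own i A $ j $ k\<bar>) + 2 * degree W i + \<delta>)"
    and iter: "iteration own f \<Omega> A b Nb W \<tau> \<nu> \<sigma> x z l"
  shows "\<exists>xs ls.
      variational_GNE own f \<Omega> A b xs \<and>
      (\<forall>y. variational_GNE own f \<Omega> A b y \<longrightarrow> y = xs) \<and>
      KKT own f \<Omega> A b xs ls \<and>
      (\<forall>i. (\<lambda>k. block own i (x k)) \<longlonglongrightarrow> block own i xs) \<and>
      (\<forall>i. (\<lambda>k. l k i) \<longlonglongrightarrow> ls)"
proof -
  let ?F = "pseudo_grad own f" and ?X = "feasible_set own \<Omega> A b"
  let ?C = "joint_set own \<Omega>" and ?d = "\<Sum>i\<in>UNIV. b i"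
  have sym: "W $ i $ j = W $ j $ i" for i j
    using arg_cong[OF A3(3), of "\<lambda>M. M $ i $ j"] by (simp add: transpose_def)
  have nonneg: "0 \<le> W $ i $ j" and adj: "j \<in> Nb i \<Longrightarrow> 0 < W $ i $ j" for i j
    using graph unfolding weighted_graph_def by (metis less_eq_real_def)+
  have deg0: "0 \<le> degree W i" for i
    unfolding degree_def by (intro sum_nonneg nonneg)
  \<comment> \<open>If the maximal degree is zero then all degrees vanish, and every \<open>\<beta>\<close> is admissible.\<close>
  have deg: "degree W i \<le> 1 / (2 * \<beta>)" for i
  proof -
    have le: "degree W i \<le> max_degree W"
      unfolding max_degree_def by (intro Max_ge) auto
    show ?thesis
    proof (cases "max_degree W = 0")
      case True
      then show ?thesis using le beta_pos by (simp add: order_trans[OF _ less_imp_le])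
    next
      case False
      then have "0 < max_degree W" using le deg0[of i] by simp
      then have "max_degree W \<le> 1 / (2 * \<beta>)"
        using beta_degree[OF False] beta_pos by (simp add: field_simps)
      then show ?thesis using le by simp
    qed
  qed
  have "\<delta> > 0" using delta beta_pos by (smt (verit) divide_pos_pos)
  have inverse_bound: "c \<le> 1 / t" if "t \<le> 1 / c" "0 < t" "0 < c" for c t :: real
    using that by (simp add: field_simps)
  have tau': "\<delta> + (\<Sum>r\<in>UNIV. \<bar>A $ r $ j\<bar>) \<le> 1 / \<tau> (own j)" for j
  proof -
    let ?s = "\<lambda>j'. \<Sum>k\<in>UNIV. \<bar>transpose (col_block own (own j) A) $ j' $ k\<bar>"
    have "?s j \<le> (MAX j'\<in>{j'. own j' = own j}. ?s j')"
      by (intro Max_ge) auto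
    moreover have "?s j = (\<Sum>r\<in>UNIV. \<bar>A $ r $ j\<bar>)"
      by (simp add: transpose_def col_block_def)
    moreover have "0 \<le> (\<Sum>r\<in>UNIV. \<bar>A $ r $ j\<bar>)" by (simp add: sum_nonneg)
    ultimately show ?thesis
      using inverse_bound[OF tau steps_pos(1), of "own j"] \<open>\<delta> > 0\<close> by linarith
  qed
  have nu': "\<delta> + 2 * degree W i \<le> 1 / \<nu> i" for i
    using inverse_bound[OF nu steps_pos(2), of i] \<open>\<delta> > 0\<close> deg0[of i] by linarith
  have sigma': "\<delta> + 2 * degree W i + (\<Sum>j | own j = i. \<bar>A $ r $ j\<bar>) \<le> 1 / \<sigma> i" for i r
  proof -
    let ?s = "\<lambda>r. \<Sum>k\<in>{k. own k = i}. \<bar>col_block own i A $ r $ k\<bar>"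
    have "?s r \<le> (MAX r\<in>UNIV. ?s r)" by (intro Max_ge) auto
    moreover have "?s r = (\<Sum>j | own j = i. \<bar>A $ r $ j\<bar>)" by (simp add: col_block_def)
    moreover have "0 \<le> (\<Sum>j | own j = i. \<bar>A $ r $ j\<bar>)" by (simp add: sum_nonneg)
    ultimately show ?thesis
      using inverse_bound[OF sigma steps_pos(3), of i] \<open>\<delta> > 0\<close> deg0[of i] by linarith
  qed

  have C: "closed ?C" "convex ?C"
    using A1_sets by (auto intro: closed_joint_set convex_joint_set)
  have X: "closed ?X" "convex ?X" "?X \<noteq> {}" "?X \<subseteq> ?C"
  proof -
    have X_eq: "?X = ?C \<inter> (\<lambda>x. A *v x - ?d) -` nonneg_orthant"
      by (auto simp: feasible_set_def nonneg_orthant_def)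
    show "closed ?X"
      unfolding X_eq by (intro closed_Int C closed_vimage closed_nonneg_orthant continuous_intros
          linear_continuous_on matrix_vector_mul_bounded_linear)
    show "convex ?X"
      unfolding X_eq
    proof (intro convex_Int C convexI vimageI2)
      fix x y u v
      assume xy: "x \<in> (\<lambda>x. A *v x - ?d) -` nonneg_orthant" "y \<in> (\<lambda>x. A *v x - ?d) -` nonneg_orthant"
        and uv: "0 \<le> u" "0 \<le> v" "u + v = (1::real)"
      have "A *v (u *\<^sub>R x + v *\<^sub>R y) - ?d = u *\<^sub>R (A *v x - ?d) + v *\<^sub>R (A *v y - ?d)"
        unfolding eq_diff_eq[THEN iffD2, OF uv(3)]
        by (simp add: matrix_vector_right_distrib matrix_vector_mult_scaleR algebra_simps)
      then show "A *v (u *\<^sub>R x + v *\<^sub>R y) - ?d \<in> nonneg_orthant"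
        using xy uv convexD[OF convex_nonneg_orthant] by simp
    qed
    show "?X \<noteq> {}" using A1_interior by auto
    show "?X \<subseteq> ?C" by (auto simp: feasible_set_def)
  qed
  obtain xs where xs: "variational_GNE own f \<Omega> A b xs"
    using strongly_monotone_VI_solvable[OF X(1-3), of \<eta> ?F \<theta>] A2_monotone A2_lipschitz A2_pos X(4)
    unfolding variational_GNE_def by blast
  have unique: "y = xs'" if "variational_GNE own f \<Omega> A b y" "variational_GNE own f \<Omega> A b xs'" for y xs'
    using VI_solution_unique[of ?X \<eta> ?F y xs'] A2_monotone A2_pos(1) X(4) that
    unfolding variational_GNE_def by blast
  obtain ls where "multiplier_pair ?F ?C A ?d xs ls"
    using variational_GNE_has_multiplier[OF C(2) A1_interior xs] by blast
  then obtain zs where solvable: "VI_solution (\<lambda>w. forward_part own f b W w + skew_part own A W w)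
      (primal_dual_domain own \<Omega>) (xs, zs, \<chi> i. ls)"
    using multiplier_pair_imp_primal_dual_VI[OF sym nonneg adj A3(2)] by blast
  define w where "w k = (x k, (\<chi> i. z k i), (\<chi> i. l k i))" for k
  have "closed (primal_dual_domain own \<Omega> :: ('n, 'm, 'p) primal_dual set)"
  proof -
    have "{l :: (real ^ 'm) ^ 'p. \<forall>i. l $ i \<in> nonneg_orthant} = (\<Inter>i. (\<lambda>l. l $ i) -` nonneg_orthant)"
      by auto
    then show ?thesis
      unfolding primal_dual_domain_def
      by (auto intro!: closed_Times C closed_vimage closed_nonneg_orthant continuous_intros)
  qed
  \<comment> \<open>The initial point is arbitrary and \<open>F\<close> is controlled only on \<open>\<Omega>\<close>, so the sequence is
    started after the first round, when all projections have been applied.\<close>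
  then have "\<exists>q. VI_solution (\<lambda>w. forward_part own f b W w + skew_part own A W w)
      (primal_dual_domain own \<Omega>) q \<and> (\<lambda>k. w (Suc k)) \<longlonglongrightarrow> q"
  proof (rule preconditioned_forward_backward_converges[where P="step_metric own A W \<tau> \<nu> \<sigma>"])
    show "w (Suc k) \<in> primal_dual_domain own \<Omega>" for k
      unfolding w_def using X(3,4) iteration_in_primal_dual_domain[OF A1_sets(1) _ iter] by blast
    show "\<beta> * (norm (forward_part own f b W u - forward_part own f b W v))\<^sup>2
        \<le> (forward_part own f b W u - forward_part own f b W v) \<bullet> (u - v)"
      if "u \<in> primal_dual_domain own \<Omega>" "v \<in> primal_dual_domain own \<Omega>" for u v
      using forward_part_cocoercive[OF sym nonneg A2_pos A2_monotone A2_lipschitz beta_pos deg beta_game] that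
      by blast
    show "(step_metric own A W \<tau> \<nu> \<sigma> (w (Suc k) - w (Suc (Suc k))) - forward_part own f b W (w (Suc k))
        - skew_part own A W (w (Suc (Suc k)))) \<bullet> (y - w (Suc (Suc k))) \<le> 0"
      if "y \<in> primal_dual_domain own \<Omega>" for k y
      by (rule iteration_primal_dual_step[OF graph A1_diff A1_sets steps_pos iter w_def that])
  qed (rule beta_pos delta solvable skew_part_skew[OF sym] step_metric_self_adjoint[OF sym]
      linear_skew_part linear_step_metric step_metric_bounded_below[OF sym nonneg tau' nu' sigma'])+
  then obtain q where q: "VI_solution (\<lambda>w. forward_part own f b W w + skew_part own A W w)
      (primal_dual_domain own \<Omega>) q" and lim: "(\<lambda>k. w (Suc k)) \<longlonglongrightarrow> q" by blast
  obtain xs' zs' lb where q_eq: "q = (xs', zs', lb)" by (metis prod.exhaust)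
  obtain ls' where lb: "lb = (\<chi> i. ls')" and pair: "multiplier_pair ?F ?C A ?d xs' ls'"
    using primal_dual_VI_imp_multiplier_pair[OF sym nonneg adj A3(2) q[unfolded q_eq]] by blast
  have w_lim: "w \<longlonglongrightarrow> (xs', zs', \<chi> i. ls')"
    using lim unfolding q_eq lb by (rule LIMSEQ_imp_Suc)
  have "(\<lambda>k. block own i (x k)) \<longlonglongrightarrow> block own i xs'" for i
  proof -
    have "x \<longlonglongrightarrow> xs'" using tendsto_fst[OF w_lim] by (simp add: w_def)
    then show ?thesis
      by (rule bounded_linear.tendsto[OF linear_conv_bounded_linear[THEN iffD1, OF linear_block]])
  qed
  moreover have "(\<lambda>k. l k i) \<longlonglongrightarrow> ls'" for i
    using tendsto_vec_nth[OF tendsto_snd[OF tendsto_snd[OF w_lim]], of i] by (simp add: w_def)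
  ultimately show ?thesis
    using multiplier_pair_imp_variational_GNE[OF pair] unique
      multiplier_pair_imp_KKT[OF private_sets A1_diff pair] by blast
qed

end
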